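(* Let $(x,y)\in\mathbb{N}^2$. (a) If $x,y\in V$ or $x,y\in D$, then $E(x,y)$ is a Cantor set with non-integer Hausdorff dimension. (b) If $x\in V$ and $y\in D$, or vice versa, then $E(x,y)$ is either a finite union of closed intervals or a Cantorval. More precisely: (i) if $y=2\cdot 4^t\cdot x$ for some $t\in\mathbb{Z}$, then $E(x,y)$ consists of $2^{\alpha}$ pairwise disjoint closed intervals, where $\alpha=t$ if $t\ge 0$ and $\alpha=-t-1$ if $t<0$; (ii) otherwise, $E(x,y)$ is a Cantorval.
   Context: $\mathbb{N}$ denotes the positive integers. For $(x,y)\in\mathbb{N}^2$, $$E(x,y)=\left\{\sum_{n=1}^{\infty}\frac{\varepsilon_n}{4^n}:(\varepsilon_n)\in\{0,x,y,x+y\}^{\mathbb{N}}\right\}\subset\mathbb{R}.$$ $V$ is the set of positive integers whose last non-zero digit in base $4$ is $1$ or $3$, and $D=\mathbb{N}\setminus V$ is the set of those whose last non-zero base-$4$ digit is $2$. A Cantor set is a set homeomorphic to the middle-third Cantor set $C_{1/3}$. A Cantorval is a set homeomorphic to $$C_{1/3}\cup\bigcup_{n=1}^{\infty}G_{2n-1}=[0,1]\setminus\bigcup_{n=1}^{\infty}G_{2n},$$ where $G_n$ is the union of the $2^{n-1}$ open middle thirds removed from $[0,1]$ at the $n$-th step of the construction of $C_{1/3}$. Closed intervals are bounded and non-degenerate. *)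

theory Defs
  imports "HOL-Analysis.Analysis"
begin

(* The series is indexed from 0, so the n-th term carries the weight 4^(n+1). *)
definition E :: "nat \<Rightarrow> nat \<Rightarrow> real set" where
  "E x y = {(\<Sum>n. real (\<epsilon> n) / 4 ^ Suc n) | \<epsilon> :: nat \<Rightarrow> nat. \<forall>n. \<epsilon> n \<in> {0, x, y, x + y}}"

definition base4_digit :: "nat \<Rightarrow> nat \<Rightarrow> nat" where
  "base4_digit n k = n div 4 ^ k mod 4"

(* Meaningful for n > 0 only. *)
definition last_nonzero_digit4 :: "nat \<Rightarrow> nat" where
  "last_nonzero_digit4 n = base4_digit n (LEAST k. base4_digit n k \<noteq> 0)"

definition V :: "nat set" where
  "V = {n. n > 0 \<and> last_nonzero_digit4 n \<in> {1, 3}}"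

definition D :: "nat set" where
  "D = {n. n > 0} - V"

(* Left endpoints of the 2^n closed intervals, each of length 1/3^n, that remain after
   n steps of the construction of the middle-third Cantor set. *)
primrec cantor_left :: "nat \<Rightarrow> real set" where
  "cantor_left 0 = {0}"
| "cantor_left (Suc n) = cantor_left n \<union> (\<lambda>a. a + 2 / 3 ^ Suc n) ` cantor_left n"

(* The open middle thirds removed at the n-th step; only used for n \<ge> 1. *)
definition G :: "nat \<Rightarrow> real set" where
  "G n = (\<Union>a\<in>cantor_left (n - 1). {a + 1 / 3 ^ n <..< a + 2 / 3 ^ n})"

definition middle_third_cantor :: "real set" where
  "middle_third_cantor = {0..1} - (\<Union>n\<in>{1..}. G n)"

definition cantor_set :: "real set \<Rightarrow> bool" where
  "cantor_set S \<longleftrightarrow> S homeomorphic middle_third_cantor"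

definition cantorval :: "real set \<Rightarrow> bool" where
  "cantorval S \<longleftrightarrow> S homeomorphic (middle_third_cantor \<union> (\<Union>n\<in>{1..}. G (2 * n - 1)))"

definition closed_interval :: "real set \<Rightarrow> bool" where
  "closed_interval I \<longleftrightarrow> (\<exists>a b. a < b \<and> I = {a..b})"

(* diam(U)^s with the usual conventions: the empty set contributes 0 for every s, and
   a non-empty set contributes 1 for s = 0.  The case distinction is needed because
   0 powr 0 = 0. *)
definition diam_pow :: "real \<Rightarrow> 'a::metric_space set \<Rightarrow> real" where
  "diam_pow s U = (if U = {} then 0 else if s = 0 then 1 else diameter U powr s)"

(* Boundedness is required explicitly because diameter is unspecified on unbounded sets. *)
definition hausdorff_premeasure :: "real \<Rightarrow> real \<Rightarrow> 'a::metric_space set \<Rightarrow> ennreal" where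
  "hausdorff_premeasure s \<delta> A =
     (INF U\<in>{U :: nat \<Rightarrow> 'a set. A \<subseteq> (\<Union>i. U i) \<and> (\<forall>i. bounded (U i) \<and> diameter (U i) \<le> \<delta>)}.
        \<Sum>i. ennreal (diam_pow s (U i)))"

definition hausdorff_measure :: "real \<Rightarrow> 'a::metric_space set \<Rightarrow> ennreal" where
  "hausdorff_measure s A = (SUP \<delta>\<in>{0<..}. hausdorff_premeasure s \<delta> A)"

definition hausdorff_dim :: "'a::metric_space set \<Rightarrow> ereal" where
  "hausdorff_dim A = (INF s\<in>{s. 0 \<le> s \<and> hausdorff_measure s A = 0}. ereal s)"

end

theory Submission
  imports Defs
begin

text \<open>
  Write \<open>E\<close> for \<open>E x y\<close>. It is the union of its four copies \<open>(d + E) / 4\<close>, where \<open>d\<close> runs through the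
  digits \<open>0\<close>, \<open>x\<close>, \<open>y\<close>, \<open>x + y\<close>, and hence for every \<open>n\<close> the union of the copies \<open>(d + E) / 4^n\<close>, where \<open>d\<close>
  runs through the integers \<open>sums4 x y n\<close> that are digit sums of length \<open>n\<close> (lemma \<open>E_level\<close>). The proof
  asks how these integers are distributed. Elements of \<open>V\<close> have an even and elements of \<open>D\<close> an odd
  exponent of \<open>2\<close>, and all that matters is whether these exponents have equal parity for \<open>x\<close> and \<open>y\<close>.

  Equal parity. Some digit sum of some length arises twice (lemma \<open>coinciding_sums\<close>). Otherwise take a
  residue class modulo some \<open>4^n\<close> that contains the largest possible number of digit sums of length
  \<open>n\<close>. By maximality the continuations of its members by \<open>k\<close> more digits are equidistributed among the
  residues modulo \<open>4^(n + k)\<close> that are compatible with the class. So an exponential sum over all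
  continuations vanishes, and it factors into an exponential sum over the fixed class
  and a product of terms \<open>1 + \<omega>^x\<close> and \<open>1 + \<omega>^y\<close> at roots of unity \<open>\<omega>\<close> of order \<open>4^i\<close>. For even
  exponents of \<open>2\<close> no such term is zero, so the sum over the class vanishes for every \<open>k\<close>. As \<open>k\<close> grows this
  sum tends to the size of the class, a contradiction. Odd exponents become even on dividing \<open>x\<close> and \<open>y\<close>
  by \<open>2\<close>, which only rescales the digit sums. A coincidence means that \<open>E\<close> consists of fewer
  than \<open>4^n\<close> copies scaled by \<open>4^(-n)\<close>. Therefore \<open>E\<close> has measure zero and dimension below \<open>1\<close>. The
  dimension is at least \<open>1/2\<close>, because reading binary digits in base \<open>4\<close> and multiplying by \<open>x\<close> maps
  the unit interval into \<open>E\<close> in such a way that points at distance \<open>\<delta>\<close> go to points at distance at least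
  \<open>\<delta>^2 / 6\<close>.

  Different parity. After removing powers of \<open>4\<close>, which replaces \<open>E\<close> by a subset, the digits form a complete residue system modulo \<open>4\<close>, so
  finitely many integer translates of it cover the unit interval and \<open>E\<close> has an interior point. If
  \<open>y = 2 * 4^t * x\<close>, the intervals are found by recursion on \<open>t\<close>. Otherwise there are scales
  \<open>X = x / 4^m\<close> and \<open>Y = y / 4^n\<close> with \<open>X < 2 * Y\<close> and \<open>Y < 2 * X\<close>. All terms below these
  scales add up to at most \<open>(X + Y) / 3\<close>, which is less than both \<open>X\<close> and \<open>Y\<close>, so \<open>E\<close> has gaps arbitrarily
  close to \<open>0\<close>. An endpoint of a gap lies in exactly one copy of each sufficiently high level, and there
  it is an extreme point of the copy. So near it \<open>E\<close> looks like \<open>E\<close> near an extreme point, and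
  gaps accumulate at it (lemma \<open>E_holes_right_of_exposed\<close>).

  Topology. The model sets are described by the binary tree of middle thirds. In a compact set whose
  gaps (and, for Cantorvals, interval components) accumulate at all relevant endpoints, one
  chooses a matching binary tree of gaps and components. The order isomorphism between the two
  trees extends to a homeomorphism of the line (lemmas \<open>cantor_set_criterion\<close> and
  \<open>cantorval_criterion\<close>).
\<close>

section \<open>Order isomorphisms between dense subsets of the line\<close>

text \<open>
  The extension sends \<open>z\<close> to the supremum of the values taken at or below \<open>z\<close>. Density of the domain makes it
  strictly increasing, density of the range makes it onto, and a monotone map onto the line has no
  room for jumps.
\<close>
lemma dense_order_isomorphism_extends:
  fixes P :: "(real \<times> real) set"
  assumes ord: "\<And>z w z' w'. (z, w) \<in> P \<Longrightarrow> (z', w') \<in> P \<Longrightarrow> z < z' \<longleftrightarrow> w < w'"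
    and dom: "\<And>u v. u < v \<Longrightarrow> \<exists>z w. (z, w) \<in> P \<and> u < z \<and> z < v"
    and ran: "\<And>u v. u < v \<Longrightarrow> \<exists>z w. (z, w) \<in> P \<and> u < w \<and> w < v"
  shows "\<exists>f f'. homeomorphism UNIV UNIV f f' \<and> (\<forall>z w. (z, w) \<in> P \<longrightarrow> f z = w)"
proof -
  define f where "f z = Sup {w. \<exists>z'\<le>z. (z', w) \<in> P}" for z
  have bound: "w \<le> w1" if "z' \<le> z" "(z', w) \<in> P" "z \<le> z1" "(z1, w1) \<in> P" for z z' w z1 w1
    using ord[OF that(4,2)] that by linarith
  have ne: "{w. \<exists>z'\<le>z. (z', w) \<in> P} \<noteq> {}" for z
    using dom[of "z - 1" z] by (auto intro: less_imp_le)
  have bdd: "bdd_above {w. \<exists>z'\<le>z. (z', w) \<in> P}" for z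
  proof -
    obtain z1 w1 where "(z1, w1) \<in> P" "z < z1" using dom[of z "z + 1"] by auto
    then show ?thesis using bound[of _ z _ z1 w1] by (intro bdd_aboveI[of _ w1]) auto
  qed
  have f_le: "f z \<le> w1" if "z \<le> z1" "(z1, w1) \<in> P" for z z1 w1
    unfolding f_def using ne bound that by (intro cSup_least) blast+
  have le_f: "w1 \<le> f z" if "z1 \<le> z" "(z1, w1) \<in> P" for z z1 w1
    unfolding f_def using bdd that by (intro cSup_upper) auto
  have ext: "f z = w" if "(z, w) \<in> P" for z w
    using f_le[OF order_refl that] le_f[OF order_refl that] by simp
  have strict: "f u < f v" if uv: "u < v" for u v
  proof -
    obtain z1 w1 where 1: "(z1, w1) \<in> P" "u < z1" "z1 < v" using dom[OF uv] by auto
    obtain z2 w2 where 2: "(z2, w2) \<in> P" "z1 < z2" "z2 < v" using dom[OF 1(3)] by auto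
    have "f u \<le> w1" "w1 < w2" "w2 \<le> f v"
      using f_le[of u z1 w1] le_f[of z2 v w2] ord[OF 1(1) 2(1)] 1 2 by auto
    then show ?thesis by linarith
  qed
  have surj: "\<exists>z. f z = w" for w
  proof -
    define S where "S = {z. \<exists>w'\<le>w. (z, w') \<in> P}"
    have S_below: "z \<le> z1" if "z \<in> S" "w < w1" "(z1, w1) \<in> P" for z z1 w1
      using that ord[OF that(3)] by (force simp: S_def)
    have "S \<noteq> {}" using ran[of "w - 1" w] by (auto simp: S_def intro: less_imp_le)
    have "bdd_above S"
    proof -
      obtain z1 w1 where "(z1, w1) \<in> P" "w < w1" using ran[of w "w + 1"] by auto
      then show ?thesis using S_below[of _ w1 z1] by (intro bdd_aboveI[of _ z1]) auto
    qed
    have "\<not> f (Sup S) < w"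
    proof
      assume "f (Sup S) < w"
      then obtain z1 w1 where 1: "(z1, w1) \<in> P" "f (Sup S) < w1" "w1 < w" using ran by blast
      then have "z1 \<le> Sup S" using \<open>bdd_above S\<close> by (intro cSup_upper) (auto simp: S_def intro: less_imp_le)
      then show False using le_f 1 by fastforce
    qed
    moreover have "\<not> w < f (Sup S)"
    proof
      assume "w < f (Sup S)"
      then obtain z1 w1 where 1: "(z1, w1) \<in> P" "w < w1" "w1 < f (Sup S)" using ran by blast
      then have "Sup S \<le> z1" using \<open>S \<noteq> {}\<close> S_below by (intro cSup_least) auto
      then show False using f_le 1 by fastforce
    qed
    ultimately show ?thesis by (intro exI[of _ "Sup S"]) linarith
  qed
  have mono: "u \<le> v \<longleftrightarrow> f u \<le> f v" for u v
    using strict[of u v] strict[of v u] by (cases u v rule: linorder_cases) auto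
  have inj: "inj f" using mono by (metis injI order_antisym order_refl)
  have "surj f" using surj by (metis surjI)
  have inv: "f (inv f w) = w" "inv f (f z) = z" for z w
    using \<open>surj f\<close> inj by (auto simp: surj_f_inv_f)
  have "continuous_on UNIV f"
    using \<open>surj f\<close> mono by (intro continuous_onI_mono) auto
  moreover have "continuous_on UNIV (inv f)"
  proof (intro continuous_onI_mono)
    show "open (range (inv f))" using inv(2) by (metis open_UNIV surjI)
    show "inv f u \<le> inv f v" if "u \<le> v" for u v using that mono inv(1) by metis
  qed
  ultimately have "homeomorphism UNIV UNIV f (inv f)"
    using inv \<open>surj f\<close> by (auto simp: homeomorphism_def) (metis rangeI)
  then show ?thesis using ext by blast
qed

text \<open>
  Map each interval of the first family affinely onto its partner and translate the two outer
  half-lines. By density of the families this is an order isomorphism between dense subsets of the line, and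
  its extension carries the removed intervals to each other.
\<close>
lemma interval_families_homeomorphism:
  fixes l r l' r' :: "'i \<Rightarrow> real"
  assumes ab: "a < b" "a' < b'"
    and lr: "\<And>i. a \<le> l i \<and> l i < r i \<and> r i \<le> b" "\<And>i. a' \<le> l' i \<and> l' i < r' i \<and> r' i \<le> b'"
    and ord: "\<And>i j. i \<noteq> j \<Longrightarrow> (r i \<le> l j \<and> r' i \<le> l' j) \<or> (r j \<le> l i \<and> r' j \<le> l' i)"
    and dense: "\<And>u v. a \<le> u \<Longrightarrow> u < v \<Longrightarrow> v \<le> b \<Longrightarrow> \<exists>i. l i < v \<and> u < r i"
      "\<And>u v. a' \<le> u \<Longrightarrow> u < v \<Longrightarrow> v \<le> b' \<Longrightarrow> \<exists>i. l' i < v \<and> u < r' i"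
  shows "({a..b} - (\<Union>i\<in>I. {l i<..<r i})) homeomorphic ({a'..b'} - (\<Union>i\<in>I. {l' i<..<r' i}))"
proof -
  define g where "g i z = l' i + (z - l i) * ((r' i - l' i) / (r i - l i))" for i z
  define h where "h i w = l i + (w - l' i) * ((r i - l i) / (r' i - l' i))" for i w
  have pos: "0 < (r' i - l' i) / (r i - l i)" "0 < (r i - l i) / (r' i - l' i)" for i
    using lr(1)[of i] lr(2)[of i] by auto
  have gh: "g i (h i w) = w" and hg: "h i (g i z) = z" for i z w
    using lr(1)[of i] lr(2)[of i] by (auto simp: g_def h_def)
  have g_less: "g i u < g i v \<longleftrightarrow> u < v" for i u v
    unfolding g_def using mult_less_cancel_right_pos[OF pos(1)[of i], of "u - l i" "v - l i"] by linarith
  have g_ends: "g i (l i) = l' i" "g i (r i) = r' i" for i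
    using lr(1)[of i] lr(2)[of i] by (auto simp: g_def)
  have g_mem: "z \<in> {l i<..<r i} \<longleftrightarrow> g i z \<in> {l' i<..<r' i}" for i z
    using g_less[of i "l i" z] g_less[of i z "r i"] g_ends[of i] by auto
  have g_img: "g i ` {l i<..<r i} = {l' i<..<r' i}" for i
  proof (intro equalityI subsetI)
    show "w \<in> g i ` {l i<..<r i}" if "w \<in> {l' i<..<r' i}" for w
      using that g_mem[of "h i w" i] unfolding gh by (intro image_eqI[of _ _ "h i w"]) (simp_all add: gh)
  qed (use g_mem in blast)
  define P where "P = {(z, w). (z < a \<and> w = z - a + a') \<or> (b < z \<and> w = z - b + b')
      \<or> (\<exists>i. z \<in> {l i<..<r i} \<and> w = g i z)}"
  have in_block: "\<exists>i. l i < z \<and> z < r i \<and> l' i < w \<and> w < r' i \<and> w = g i z"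
    if "(z, w) \<in> P" "\<not> z < a" "\<not> b < z" for z w
    using that g_mem by (fastforce simp: P_def)
  have ordP: "w < w'" if zw: "(z, w) \<in> P" "(z', w') \<in> P" "z < z'" for z w z' w'
  proof -
    have outside: "(z < a \<longrightarrow> w = z - a + a') \<and> (b < z \<longrightarrow> w = z - b + b') \<and>
      (a \<le> z \<and> z \<le> b \<longrightarrow> a' < w \<and> w < b')" if zw: "(z, w) \<in> P" for z w
    proof (cases "a \<le> z \<and> z \<le> b")
      case True
      then obtain i where "l' i < w" "w < r' i" using in_block[OF zw] by auto
      then show ?thesis using True lr(2)[of i] by auto
    next
      case False
      have "\<not> z \<in> {l i<..<r i}" for i using False lr(1)[of i] by auto
      then show ?thesis using zw False ab(1) by (auto simp: P_def)
    qed
    show ?thesis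
    proof (cases "a \<le> z \<and> z' \<le> b")
      case True
      obtain i where i: "l i < z" "z < r i" "l' i < w" "w < r' i" "w = g i z"
        using in_block[OF zw(1)] True zw(3) by auto
      obtain j where j: "l j < z'" "z' < r j" "l' j < w'" "w' < r' j" "w' = g j z'"
        using in_block[OF zw(2)] True zw(3) by auto
      show ?thesis
      proof (cases "i = j")
        case True then show ?thesis using i j g_less zw(3) by auto
      next
        case False
        then show ?thesis using ord[OF False] i j zw(3) by linarith
      qed
    next
      case False
      then show ?thesis using outside[OF zw(1)] outside[OF zw(2)] zw(3) ab by linarith
    qed
  qed
  have funP: "w = w'" if zw: "(z, w) \<in> P" "(z, w') \<in> P" for z w w'
  proof (cases "a \<le> z \<and> z \<le> b")
    case True
    obtain i where i: "l i < z" "z < r i" "w = g i z"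
      using in_block[OF zw(1)] True by auto
    obtain j where j: "l j < z" "z < r j" "w' = g j z"
      using in_block[OF zw(2)] True by auto
    have "i = j" using ord[of i j] i j by force
    then show ?thesis using i j by simp
  next
    case False
    have "\<not> z \<in> {l i<..<r i}" for i using False lr(1)[of i] by auto
    then show ?thesis using zw False ab(1) by (auto simp: P_def)
  qed
  have "\<exists>f f'. homeomorphism UNIV UNIV f f' \<and> (\<forall>z w. (z, w) \<in> P \<longrightarrow> f z = w)"
  proof (rule dense_order_isomorphism_extends[of P])
    show "z < z' \<longleftrightarrow> w < w'" if "(z, w) \<in> P" "(z', w') \<in> P" for z w z' w'
    proof (cases z z' rule: linorder_cases)
      case equal then show ?thesis using funP that by blast
    qed (use ordP that in fastforce)+
  next
    fix u v :: real assume "u < v"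
    show "\<exists>z w. (z, w) \<in> P \<and> u < z \<and> z < v"
    proof (cases "u < a \<or> b < v")
      case True
      then have "u < min a v \<or> max b u < v" using \<open>u < v\<close> by auto
      then obtain z where "u < z" "z < v" "z < a \<or> b < z" by (metis Orderings.dense min_less_iff_conj max_less_iff_conj)
      then show ?thesis unfolding P_def by blast
    next
      case False
      then obtain i where i: "l i < v" "u < r i" using dense(1)[of u v] \<open>u < v\<close> by auto
      then have "max (l i) u < min (r i) v" using lr(1)[of i] \<open>u < v\<close> by simp
      from Orderings.dense[OF this] obtain z where "max (l i) u < z" "z < min (r i) v" by auto
      then show ?thesis by (intro exI[of _ z] exI[of _ "g i z"]) (auto simp: P_def)
    qed
  next
    fix u v :: real assume "u < v"
    show "\<exists>z w. (z, w) \<in> P \<and> u < w \<and> w < v"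
    proof (cases "u < a' \<or> b' < v")
      case True
      then have "u < min a' v \<or> max b' u < v" using \<open>u < v\<close> by auto
      then obtain w where w: "u < w" "w < v" "w < a' \<or> b' < w" by (metis Orderings.dense min_less_iff_conj max_less_iff_conj)
      then have "(w - a' + a, w) \<in> P \<or> (w - b' + b, w) \<in> P" by (auto simp: P_def)
      then show ?thesis using w by blast
    next
      case False
      then obtain i where i: "l' i < v" "u < r' i" using dense(2)[of u v] \<open>u < v\<close> by auto
      then have "max (l' i) u < min (r' i) v" using lr(2)[of i] \<open>u < v\<close> by auto
      from Orderings.dense[OF this] obtain w where w: "max (l' i) u < w" "w < min (r' i) v" by auto
      then have "(h i w, w) \<in> P" using g_mem[of "h i w" i] gh by (auto simp: P_def)
      then show ?thesis using w by auto
    qed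
  qed
  then obtain f f' where f: "homeomorphism UNIV UNIV f f'"
    and fP: "\<And>z w. (z, w) \<in> P \<Longrightarrow> f z = w" by blast
  have inj: "inj f" using f by (metis homeomorphism_apply1 UNIV_I injI)
  have bij: "surj f" using f by (auto simp: homeomorphism_def)
  have "f ` {..<a} = {..<a'}"
  proof -
    have "f ` {..<a} = (\<lambda>z. z - a + a') ` {..<a}" by (rule image_cong) (auto intro!: fP simp: P_def)
    also have "\<dots> = {..<a'}"
    proof (intro equalityI subsetI)
      show "w \<in> (\<lambda>z. z - a + a') ` {..<a}" if "w \<in> {..<a'}" for w
        using that by (intro image_eqI[of _ _ "w - a' + a"]) auto
    qed auto
    finally show ?thesis .
  qed
  moreover have "f ` {b<..} = {b'<..}"
  proof -
    have "f ` {b<..} = (\<lambda>z. z - b + b') ` {b<..}" by (rule image_cong) (auto intro!: fP simp: P_def)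
    also have "\<dots> = {b'<..}"
    proof (intro equalityI subsetI)
      show "w \<in> (\<lambda>z. z - b + b') ` {b<..}" if "w \<in> {b'<..}" for w
        using that by (intro image_eqI[of _ _ "w - b' + b"]) auto
    qed auto
    finally show ?thesis .
  qed
  moreover have "f ` {l i<..<r i} = {l' i<..<r' i}" for i
  proof -
    have "f ` {l i<..<r i} = g i ` {l i<..<r i}" by (rule image_cong) (auto intro!: fP simp: P_def)
    then show ?thesis using g_img by simp
  qed
  moreover have "{a..b} - (\<Union>i\<in>I. {l i<..<r i}) = UNIV - ({..<a} \<union> {b<..} \<union> (\<Union>i\<in>I. {l i<..<r i}))"
    "{a'..b'} - (\<Union>i\<in>I. {l' i<..<r' i}) = UNIV - ({..<a'} \<union> {b'<..} \<union> (\<Union>i\<in>I. {l' i<..<r' i}))"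
    by auto
  ultimately have "f ` ({a..b} - (\<Union>i\<in>I. {l i<..<r i})) = {a'..b'} - (\<Union>i\<in>I. {l' i<..<r' i})"
    using bij by (simp only: image_set_diff[OF inj] image_Un image_UN)
  from homeomorphism_of_subsets[OF f subset_UNIV subset_UNIV this]
  show ?thesis unfolding homeomorphic_def by blast
qed

section \<open>Trees of intervals and the Cantor construction\<close>

text \<open>
  A node of the infinite binary tree is the list of turns that leads to it, the last turn first and
  \<open>False\<close> meaning left. Then a child is formed by \<open>Cons\<close>, and descendants of \<open>u\<close> are the lists \<open>p @ u\<close>.
  The relation is the strict infix order of the tree.
\<close>
definition inorder :: "bool list \<Rightarrow> bool list \<Rightarrow> bool" where
  "inorder s t \<longleftrightarrow> (\<exists>u p q. (s = p @ False # u \<and> (t = u \<or> t = q @ True # u)) \<or> (s = u \<and> t = q @ True # u))"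

lemma inorderI:
  "inorder (p @ False # u) u" "inorder u (q @ True # u)" "inorder (p @ False # u) (q @ True # u)"
  unfolding inorder_def by blast+

lemma inorder_total:
  assumes "s \<noteq> t"
  shows "inorder s t \<or> inorder t s"
proof -
  \<comment> \<open>Split both paths at their lowest common ancestor.\<close>
  have "\<exists>p q u. s = p @ u \<and> t = q @ u \<and> (p = [] \<or> q = [] \<or> last p \<noteq> last q)"
  proof (induction s arbitrary: t rule: rev_induct)
    case Nil
    show ?case by auto
  next
    case (snoc c s)
    show ?case
    proof (cases t rule: rev_cases)
      case Nil
      then show ?thesis by auto
    next
      case t: (snoc t' d)
      show ?thesis
      proof (cases "c = d")
        case True
        from snoc[of t'] obtain p q u where
          "s = p @ u" "t' = q @ u" "p = [] \<or> q = [] \<or> last p \<noteq> last q" by blast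
        then show ?thesis using True t
          by (intro exI[of _ p] exI[of _ q] exI[of _ "u @ [c]"]) auto
      next
        case False
        then show ?thesis using t by (intro exI[of _ "s @ [c]"] exI[of _ t] exI[of _ "[]"]) auto
      qed
    qed
  qed
  then obtain p q u where u: "s = p @ u" "t = q @ u" "p = [] \<or> q = [] \<or> last p \<noteq> last q" by blast
  show ?thesis
  proof (cases p rule: rev_cases; cases q rule: rev_cases)
    fix p' c q' d assume "p = p' @ [c]" "q = q' @ [d]"
    then show ?thesis using u by (cases c; cases d) (auto intro: inorderI)
  next
    fix p' c assume "p = p' @ [c]" "q = []"
    then show ?thesis using u by (cases c) (auto intro: inorderI)
  next
    fix q' d assume "p = []" "q = q' @ [d]"
    then show ?thesis using u by (cases d) (auto intro: inorderI)
  qed (use u assms in auto)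
qed

text \<open>
  At each node \<open>s\<close> the interval from \<open>L s\<close> to \<open>R s\<close> is cut into a left part, a block from \<open>l s\<close> to \<open>r s\<close> and a
  right part, and the two outer parts are the intervals of the children.
\<close>
locale interval_tree =
  fixes a b :: real and L l r R :: "bool list \<Rightarrow> real"
  assumes root: "L [] = a" "R [] = b"
    and left: "L (False # s) = L s" "R (False # s) = l s"
    and right: "L (True # s) = r s" "R (True # s) = R s"
    and block: "L s \<le> l s" "l s < r s" "r s \<le> R s"
begin

lemma node_bounds: "L s \<le> L (p @ s)" "R (p @ s) \<le> R s"
proof (induction p)
  case (Cons c p)
  have "L (p @ s) \<le> L (c # p @ s)" "R (c # p @ s) \<le> R (p @ s)"
    using block[of "p @ s"] by (cases c; simp add: left right)+
  then show "L s \<le> L ((c # p) @ s)" "R ((c # p) @ s) \<le> R s" using Cons by simp_all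
qed auto

lemma block_bounds: "a \<le> l s" "r s \<le> b"
  using node_bounds[where s = "[]" and p = s] block[of s] by (auto simp: root)

lemma inorder_blocks:
  assumes "inorder s t"
  shows "r s \<le> l t"
proof -
  have F: "r (p @ False # u) \<le> l u" and T: "r u \<le> l (p @ True # u)" for p u
    using node_bounds[where s = "False # u" and p = p] node_bounds[where s = "True # u" and p = p]
      block[of "p @ False # u"] block[of "p @ True # u"] by (auto simp: left right)
  show ?thesis using assms F T block(2)
    unfolding inorder_def by (metis dual_order.trans less_imp_le)
qed

lemma blocks_inj: "l s = l t \<Longrightarrow> s = t"
  using inorder_blocks[of s t] inorder_blocks[of t s] inorder_total[of s t] block(2)[of s] block(2)[of t]
  by fastforce

lemma blocks_disjoint: "s \<noteq> t \<Longrightarrow> {l s<..<r s} \<inter> {l t<..<r t} = {}"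
  using inorder_blocks[of s t] inorder_blocks[of t s] inorder_total[of s t] by auto

end

text \<open>
  In both trees the blocks are ordered like their nodes, so matching blocks by nodes preserves order.
\<close>
lemma interval_trees_homeomorphic:
  assumes "interval_tree a b L l r R" "interval_tree a' b' L' l' r' R'"
    and dense: "\<And>u v. a \<le> u \<Longrightarrow> u < v \<Longrightarrow> v \<le> b \<Longrightarrow> \<exists>s. l s < v \<and> u < r s"
      "\<And>u v. a' \<le> u \<Longrightarrow> u < v \<Longrightarrow> v \<le> b' \<Longrightarrow> \<exists>s. l' s < v \<and> u < r' s"
  shows "({a..b} - (\<Union>s\<in>I. {l s<..<r s})) homeomorphic ({a'..b'} - (\<Union>s\<in>I. {l' s<..<r' s}))"
proof -
  interpret t: interval_tree a b L l r R by fact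
  interpret t': interval_tree a' b' L' l' r' R' by fact
  show ?thesis
  proof (rule interval_families_homeomorphism[OF _ _ _ _ _ dense])
    show "a < b" "a' < b'"
      using t.block_bounds[of "[]"] t.block[of "[]"] t'.block_bounds[of "[]"] t'.block[of "[]"] by auto
    show "r i \<le> l j \<and> r' i \<le> l' j \<or> r j \<le> l i \<and> r' j \<le> l' i" if "i \<noteq> j" for i j
      using inorder_total[OF that] t.inorder_blocks t'.inorder_blocks by blast
  qed (use t.block_bounds t.block t'.block_bounds t'.block in auto)
qed

text \<open>
  \<open>B\<close> is a set of disjoint coloured intervals that is to be arranged as an interval tree in which
  the nodes at depth \<open>n\<close> carry the colour \<open>\<kappa> n\<close>. The endpoints at which blocks accumulate are those that can
  bound a node of such a tree, so that a block of any prescribed colour is found strictly inside every node.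
\<close>
locale accumulating_blocks =
  fixes a b :: real and B :: "(real \<times> real) set" and colour :: "real \<times> real \<Rightarrow> 'c" and \<kappa> :: "nat \<Rightarrow> 'c"
  assumes ab: "a < b"
    and block_ends: "\<beta> \<in> B \<Longrightarrow> a \<le> fst \<beta> \<and> fst \<beta> < snd \<beta> \<and> snd \<beta> \<le> b"
    and disj: "\<beta> \<in> B \<Longrightarrow> \<gamma> \<in> B \<Longrightarrow> \<beta> \<noteq> \<gamma> \<Longrightarrow> snd \<beta> \<le> fst \<gamma> \<or> snd \<gamma> \<le> fst \<beta>"
    and acc_right: "p \<in> insert a (snd ` B) \<Longrightarrow> 0 < e \<Longrightarrow>
      \<exists>\<beta>\<in>B. colour \<beta> = \<kappa> n \<and> p < fst \<beta> \<and> snd \<beta> < p + e"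
    and acc_left: "q \<in> insert b (fst ` B) \<Longrightarrow> 0 < e \<Longrightarrow>
      \<exists>\<beta>\<in>B. colour \<beta> = \<kappa> n \<and> q - e < fst \<beta> \<and> snd \<beta> < q"
    and dense: "a \<le> u \<Longrightarrow> u < v \<Longrightarrow> v \<le> b \<Longrightarrow> \<exists>\<beta>\<in>B. fst \<beta> < v \<and> u < snd \<beta>"
    and recurrent: "\<beta> \<in> B \<Longrightarrow> infinite {n. \<kappa> n = colour \<beta>}"
begin

lemma countable_blocks: "countable B"
proof -
  define I where "I \<beta> = {fst \<beta><..<snd \<beta>}" for \<beta> :: "real \<times> real"
  have ne: "I \<beta> \<noteq> {}" if "\<beta> \<in> B" for \<beta>
    using block_ends[OF that] by (auto simp: I_def)
  have I_disj: "I \<beta> \<inter> I \<gamma> = {}" if "\<beta> \<in> B" "\<gamma> \<in> B" "\<beta> \<noteq> \<gamma>" for \<beta> \<gamma>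
    using disj[OF that] by (auto simp: I_def)
  have "countable (I ` B)"
  proof (rule countable_disjoint_open_subsets)
    show "pairwise disjnt (I ` B)"
    proof (rule pairwiseI)
      fix U W assume "U \<in> I ` B" "W \<in> I ` B" "U \<noteq> W"
      then obtain \<beta> \<gamma> where "\<beta> \<in> B" "\<gamma> \<in> B" "\<beta> \<noteq> \<gamma>" "U = I \<beta>" "W = I \<gamma>" by blast
      then show "disjnt U W" using I_disj[of \<beta> \<gamma>] by (simp add: disjnt_def)
    qed
  qed (auto simp: I_def)
  moreover have "inj_on I B"
    proof (rule inj_onI, rule ccontr)
    fix \<beta> \<gamma> assume "\<beta> \<in> B" "\<gamma> \<in> B" "I \<beta> = I \<gamma>" "\<beta> \<noteq> \<gamma>"
    then show False using I_disj[of \<beta> \<gamma>] ne[of \<beta>] by simp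
  qed
  ultimately show ?thesis by (rule countable_image_inj_on)
qed

text \<open>
  Blocks are chosen by least index in a fixed enumeration. This is what forces every block to
  be chosen eventually.
\<close>
definition pick :: "nat \<Rightarrow> real \<times> real \<Rightarrow> real \<times> real" where
  "pick n pq = (ARG_MIN (to_nat_on B) \<beta>. \<beta> \<in> B \<and> colour \<beta> = \<kappa> n \<and> fst pq < fst \<beta> \<and> snd \<beta> < snd pq)"

primrec node :: "bool list \<Rightarrow> real \<times> real" where
  "node [] = (a, b)"
| "node (c # s) = (if c then (snd (pick (length s) (node s)), snd (node s))
     else (fst (node s), fst (pick (length s) (node s))))"

abbreviation "chosen s \<equiv> pick (length s) (node s)"

lemma pick:
  assumes "p \<in> insert a (snd ` B)" "p < q"
  shows "pick n (p, q) \<in> B" "colour (pick n (p, q)) = \<kappa> n"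
    "p < fst (pick n (p, q))" "snd (pick n (p, q)) < q"
    "\<And>\<beta>. \<beta> \<in> B \<Longrightarrow> colour \<beta> = \<kappa> n \<Longrightarrow> p < fst \<beta> \<Longrightarrow> snd \<beta> < q \<Longrightarrow>
      to_nat_on B (pick n (p, q)) \<le> to_nat_on B \<beta>"
proof -
  let ?P = "\<lambda>\<beta>. \<beta> \<in> B \<and> colour \<beta> = \<kappa> n \<and> p < fst \<beta> \<and> snd \<beta> < q"
  obtain \<beta> where "?P \<beta>" using acc_right[OF assms(1), of "q - p" n] assms(2) by force
  from arg_min_nat_lemma[of ?P, OF this]
  show "pick n (p, q) \<in> B" "colour (pick n (p, q)) = \<kappa> n"
    "p < fst (pick n (p, q))" "snd (pick n (p, q)) < q"
    "\<And>\<beta>. \<beta> \<in> B \<Longrightarrow> colour \<beta> = \<kappa> n \<Longrightarrow> p < fst \<beta> \<Longrightarrow> snd \<beta> < q \<Longrightarrow>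
      to_nat_on B (pick n (p, q)) \<le> to_nat_on B \<beta>"
    by (auto simp: pick_def)
qed

lemma node_ends: "fst (node s) \<in> insert a (snd ` B) \<and> snd (node s) \<in> insert b (fst ` B) \<and> fst (node s) < snd (node s)"
proof (induction s)
  case (Cons c s)
  then show ?case using pick[where p = "fst (node s)" and q = "snd (node s)" and n = "length s"] by auto
qed (use ab in auto)

lemma chosen:
  "chosen s \<in> B" "colour (chosen s) = \<kappa> (length s)"
  "fst (node s) < fst (chosen s)" "snd (chosen s) < snd (node s)"
  "\<beta> \<in> B \<Longrightarrow> colour \<beta> = \<kappa> (length s) \<Longrightarrow> fst (node s) < fst \<beta> \<Longrightarrow> snd \<beta> < snd (node s) \<Longrightarrow>
      to_nat_on B (chosen s) \<le> to_nat_on B \<beta>"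
  using pick[where p = "fst (node s)" and q = "snd (node s)" and n = "length s"] node_ends[of s] by auto

sublocale interval_tree a b "\<lambda>s. fst (node s)" "\<lambda>s. fst (chosen s)" "\<lambda>s. snd (chosen s)" "\<lambda>s. snd (node s)"
  using chosen(3,4) block_ends[OF chosen(1)] by unfold_locales (auto intro: less_imp_le)

text \<open>
  Blocks accumulating at a common endpoint would have to enter one of the two adjacent blocks.
\<close>
lemma not_adjacent:
  assumes "\<beta> \<in> B"
  shows "p \<in> insert a (snd ` B) \<Longrightarrow> p \<noteq> fst \<beta>" "q \<in> insert b (fst ` B) \<Longrightarrow> q \<noteq> snd \<beta>"
proof -
  have 0: "0 < snd \<beta> - fst \<beta>" using block_ends[OF assms] by simp
  show "p \<noteq> fst \<beta>" if p_end: "p \<in> insert a (snd ` B)"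
  proof
    assume p: "p = fst \<beta>"
    obtain \<gamma> where "\<gamma> \<in> B" "p < fst \<gamma>" "snd \<gamma> < snd \<beta>" using acc_right[OF p_end 0, of 0] p by auto
    then show False using disj[OF assms, of \<gamma>] block_ends[of \<gamma>] p by fastforce
  qed
  show "q \<noteq> snd \<beta>" if q_end: "q \<in> insert b (fst ` B)"
  proof
    assume q: "q = snd \<beta>"
    obtain \<gamma> where "\<gamma> \<in> B" "fst \<beta> < fst \<gamma>" "snd \<gamma> < q" using acc_left[OF q_end 0, of 0] q by auto
    then show False using disj[OF assms, of \<gamma>] block_ends[of \<gamma>] q by fastforce
  qed
qed

text \<open>
  A block that is never chosen lies inside one node at every depth. At each depth of its colour it
  loses against a block of smaller index, and these infinitely many winners are distinct.
\<close>
lemma all_chosen: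
  assumes "\<beta> \<in> B"
  obtains s where "chosen s = \<beta>"
proof (rule ccontr)
  assume "\<not> thesis"
  then have not_chosen: "chosen s \<noteq> \<beta>" for s using that by blast
  have "\<exists>s. length s = n \<and> fst (node s) < fst \<beta> \<and> snd \<beta> < snd (node s)" for n
  proof (induction n)
    case 0
    show ?case using not_adjacent(1)[OF assms, of a] not_adjacent(2)[OF assms, of b] block_ends[OF assms] by (intro exI[of _ "[]"]) auto
  next
    case (Suc n)
    then obtain s where s: "length s = n" "fst (node s) < fst \<beta>" "snd \<beta> < snd (node s)" by blast
    have "snd (chosen s) < fst \<beta> \<or> snd \<beta> < fst (chosen s)"
      using disj[OF chosen(1)[of s] assms not_chosen] chosen(1)[of s]
        not_adjacent(1)[OF assms, of "snd (chosen s)"] not_adjacent(2)[OF assms, of "fst (chosen s)"] by fastforce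
    then show ?case
    proof
      assume "snd (chosen s) < fst \<beta>"
      then show ?thesis using s by (intro exI[of _ "True # s"]) auto
    next
      assume "snd \<beta> < fst (chosen s)"
      then show ?thesis using s by (intro exI[of _ "False # s"]) auto
    qed
  qed
  then obtain s where s: "\<And>n. length (s n) = n" "\<And>n. fst (node (s n)) < fst \<beta>" "\<And>n. snd \<beta> < snd (node (s n))"
    by metis
  define N where "N = {n. \<kappa> n = colour \<beta>}"
  have "(\<lambda>n. to_nat_on B (chosen (s n))) ` N \<subseteq> {..to_nat_on B \<beta>}"
  proof (rule image_subsetI, unfold atMost_iff)
    fix n assume "n \<in> N"
    then show "to_nat_on B (chosen (s n)) \<le> to_nat_on B \<beta>"
      using s by (intro chosen(5)[OF assms]) (simp_all add: N_def)
  qed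
  then have "finite ((\<lambda>n. to_nat_on B (chosen (s n))) ` N)" by (rule finite_subset) simp
  moreover have "inj_on (\<lambda>n. to_nat_on B (chosen (s n))) N"
  proof (rule inj_onI)
    fix m n assume "to_nat_on B (chosen (s m)) = to_nat_on B (chosen (s n))"
    then have "chosen (s m) = chosen (s n)"
      using countable_blocks chosen(1) by (simp add: inj_on_eq_iff[OF inj_on_to_nat_on])
    then have "s m = s n" by (intro blocks_inj) simp
    then show "m = n" using s(1) by metis
  qed
  ultimately show False using recurrent[OF assms] finite_imageD unfolding N_def by blast
qed

lemma chosen_dense: "a \<le> u \<Longrightarrow> u < v \<Longrightarrow> v \<le> b \<Longrightarrow> \<exists>s. fst (chosen s) < v \<and> u < snd (chosen s)"
  using dense all_chosen by metis

lemma chosen_coloured: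
  "(\<Union>s\<in>{s :: bool list. P (\<kappa> (length s))}. {fst (chosen s)<..<snd (chosen s)}) =
   (\<Union>\<beta>\<in>{\<beta>\<in>B. P (colour \<beta>)}. {fst \<beta><..<snd \<beta>})"
proof (intro equalityI UN_least)
  fix \<beta> assume "\<beta> \<in> {\<beta>\<in>B. P (colour \<beta>)}"
  then obtain s where s: "chosen s = \<beta>" "P (colour \<beta>)" using all_chosen by blast
  then have "P (\<kappa> (length s))" using chosen(2)[of s] by simp
  then show "{fst \<beta><..<snd \<beta>} \<subseteq> (\<Union>s\<in>{s :: bool list. P (\<kappa> (length s))}. {fst (chosen s)<..<snd (chosen s)})"
    using s by blast
next
  fix s :: "bool list" assume "s \<in> {s. P (\<kappa> (length s))}"
  then have "chosen s \<in> {\<beta>\<in>B. P (colour \<beta>)}" using chosen(1,2) by simp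
  then show "{fst (chosen s)<..<snd (chosen s)} \<subseteq> (\<Union>\<beta>\<in>{\<beta>\<in>B. P (colour \<beta>)}. {fst \<beta><..<snd \<beta>})"
    by blast
qed

end

text \<open>
  The left endpoint of the interval of a node in the construction of the middle-third Cantor set.
\<close>
primrec cantor_point :: "bool list \<Rightarrow> real" where
  "cantor_point [] = 0"
| "cantor_point (c # s) = cantor_point s + (if c then 2 / 3 ^ Suc (length s) else 0)"

abbreviation "third_left s \<equiv> cantor_point s + 1 / 3 ^ Suc (length s)"
abbreviation "third_right s \<equiv> cantor_point s + 2 / 3 ^ Suc (length s)"

interpretation cantor_tree: interval_tree 0 1 cantor_point third_left third_right
  "\<lambda>s. cantor_point s + 1 / 3 ^ length s"
  by unfold_locales (auto simp: field_simps)

lemma cantor_left_eq: "cantor_left n = cantor_point ` {s. length s = n}"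
proof (induction n)
  case (Suc n)
  have "{s :: bool list. length s = Suc n} = (#) False ` {s. length s = n} \<union> (#) True ` {s. length s = n}"
    by (auto simp: length_Suc_conv image_iff)
  then show ?case by (auto simp: Suc image_Un image_image)
qed auto

lemma G_eq: "n \<ge> 1 \<Longrightarrow> G n = (\<Union>s\<in>{s. Suc (length s) = n}. {third_left s<..<third_right s})"
  by (cases n) (auto simp: G_def cantor_left_eq)

text \<open>
  An interval meeting no middle third would stay inside one node at every depth, but nodes at depth \<open>n\<close>
  have length \<open>1 / 3 ^ n\<close>.
\<close>
lemma thirds_dense:
  assumes "0 \<le> u" "u < v" "v \<le> 1"
  shows "\<exists>s. third_left s < v \<and> u < third_right s"
proof (rule ccontr)
  assume none: "\<not> ?thesis"
  have "\<exists>s. length s = n \<and> cantor_point s \<le> u \<and> v \<le> cantor_point s + 1 / 3 ^ length s" for n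
  proof (induction n)
    case (Suc n)
    then obtain s where s: "length s = n" "cantor_point s \<le> u" "v \<le> cantor_point s + 1 / 3 ^ length s" by blast
    have "v \<le> third_left s \<or> third_right s \<le> u" using none by (meson not_le)
    then show ?case
    proof
      assume "v \<le> third_left s"
      then show ?thesis using s by (intro exI[of _ "False # s"]) auto
    next
      assume "third_right s \<le> u"
      then show ?thesis using s by (intro exI[of _ "True # s"]) (auto simp: field_simps)
    qed
  qed (use assms in auto)
  then have le: "v - u \<le> (1/3) ^ n" for n
  proof -
    obtain s :: "bool list" where "length s = n" "cantor_point s \<le> u" "v \<le> cantor_point s + 1 / 3 ^ length s"
      using \<open>\<And>n. \<exists>s. length s = n \<and> cantor_point s \<le> u \<and> v \<le> cantor_point s + 1 / 3 ^ length s\<close> by blast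
    then show ?thesis by (simp add: power_one_over)
  qed
  obtain n where "(1/3 :: real) ^ n < v - u"
    using real_arch_pow_inv[of "v - u" "1/3"] assms by auto
  then show False using le[of n] by simp
qed

lemma G_disjoint:
  assumes "m \<ge> 1" "n \<ge> 1" "m \<noteq> n"
  shows "G m \<inter> G n = {}"
proof (rule equals0I)
  fix z assume "z \<in> G m \<inter> G n"
  then obtain s t :: "bool list" where "Suc (length s) = m" "Suc (length t) = n"
    "z \<in> {third_left s<..<third_right s}" "z \<in> {third_left t<..<third_right t}"
    unfolding G_eq[OF assms(1)] G_eq[OF assms(2)] by blast
  moreover have "s \<noteq> t" using calculation(1,2) assms(3) by blast
  ultimately show False using cantor_tree.blocks_disjoint[of s t] by blast
qed

lemma G_subset: "n \<ge> 1 \<Longrightarrow> G n \<subseteq> {0..1}"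
proof -
  assume n: "n \<ge> 1"
  have "{third_left s<..<third_right s} \<subseteq> {0..1}" for s
    using cantor_tree.block_bounds[of s] by auto
  then show ?thesis unfolding G_eq[OF n] by blast
qed

context accumulating_blocks
begin

lemma homeomorphic_cantor_tree:
  "({a..b} - (\<Union>\<beta>\<in>{\<beta>\<in>B. P (colour \<beta>)}. {fst \<beta><..<snd \<beta>})) homeomorphic
   ({0..1} - (\<Union>n\<in>{n. P (\<kappa> n)}. G (Suc n)))"
proof -
  have "(\<Union>n\<in>{n. P (\<kappa> n)}. G (Suc n)) = (\<Union>s\<in>{s. P (\<kappa> (length s))}. {third_left s<..<third_right s})"
    unfolding G_eq[OF le_add1[of 1, unfolded plus_1_eq_Suc]] by auto
  moreover have "({a..b} - (\<Union>s\<in>{s. P (\<kappa> (length s))}. {fst (chosen s)<..<snd (chosen s)})) homeomorphic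
    ({0..1} - (\<Union>s\<in>{s. P (\<kappa> (length s))}. {third_left s<..<third_right s}))"
    by (rule interval_trees_homeomorphic[OF interval_tree_axioms cantor_tree.interval_tree_axioms
          chosen_dense thirds_dense])
  ultimately show ?thesis unfolding chosen_coloured by simp
qed

end

section \<open>Recognising Cantor sets and Cantorvals\<close>

definition gap :: "real set \<Rightarrow> real \<times> real \<Rightarrow> bool" where
  "gap K \<beta> \<longleftrightarrow> fst \<beta> \<in> K \<and> snd \<beta> \<in> K \<and> fst \<beta> < snd \<beta> \<and> {fst \<beta><..<snd \<beta>} \<inter> K = {}"

text \<open>
  A non-degenerate connected component, described by its two endpoints.
\<close>
definition solid :: "real set \<Rightarrow> real \<times> real \<Rightarrow> bool" where
  "solid K \<beta> \<longleftrightarrow> fst \<beta> < snd \<beta> \<and> {fst \<beta>..snd \<beta>} \<subseteq> K \<and>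
     (\<forall>u v. u \<le> fst \<beta> \<longrightarrow> snd \<beta> \<le> v \<longrightarrow> {u..v} \<subseteq> K \<longrightarrow> u = fst \<beta> \<and> v = snd \<beta>)"

lemma gap_exists:
  assumes "closed K" "p \<in> K" "q \<in> K" "p < z" "z < q" "z \<notin> K"
  obtains \<beta> where "gap K \<beta>" "p \<le> fst \<beta>" "fst \<beta> < z" "z < snd \<beta>" "snd \<beta> \<le> q"
proof -
  have c: "compact (K \<inter> {p..z})" "compact (K \<inter> {z..q})"
    using assms(1) by (auto intro: closed_Int_compact)
  have "K \<inter> {p..z} \<noteq> {}" "K \<inter> {z..q} \<noteq> {}" using assms by (auto intro: less_imp_le)
  then obtain l r where l: "l \<in> K \<inter> {p..z}" "\<And>t. t \<in> K \<inter> {p..z} \<Longrightarrow> t \<le> l"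
    and r: "r \<in> K \<inter> {z..q}" "\<And>t. t \<in> K \<inter> {z..q} \<Longrightarrow> r \<le> t"
    using compact_attains_sup[OF c(1)] compact_attains_inf[OF c(2)] by metis
  have "l < z" "z < r" using l(1) r(1) assms(6) by (auto simp: less_le)
  moreover have "t \<notin> K" if "l < t" "t < r" for t
    using l r that by (cases "t \<le> z") force+
  ultimately show thesis using l(1) r(1) by (intro that[of "(l, r)"]) (auto simp: gap_def)
qed

lemma solid_exists:
  assumes "compact K" "u < v" "{u..v} \<subseteq> K"
  obtains \<beta> where "solid K \<beta>" "fst \<beta> \<le> u" "v \<le> snd \<beta>"
proof -
  let ?C = "connected_component_set K u"
  have "u \<in> K" using assms by auto
  have "compact ?C"
    using assms(1) by (meson bounded_subset closed_connected_component compact_eq_bounded_closed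
        connected_component_subset)
  then obtain l r where C: "?C = {l..r}"
    using connected_compact_interval_1 connected_connected_component by metis
  have maximal: "{u'..v'} \<subseteq> ?C" if "{u'..v'} \<subseteq> K" "u' \<le> u" "u \<le> v'" for u' v'
    using that by (intro connected_component_maximal) auto
  have "{u..v} \<subseteq> {l..r}" using maximal[of u v] assms C by auto
  then have uv: "l \<le> u" "v \<le> r" using assms(2) by auto
  have "{l..r} \<subseteq> K" using C connected_component_subset by metis
  moreover have "u' = l \<and> v' = r" if "u' \<le> l" "r \<le> v'" "{u'..v'} \<subseteq> K" for u' v'
  proof -
    have "{u'..v'} \<subseteq> {l..r}" using maximal[of u' v'] that uv assms(2) C by auto
    then show ?thesis using that uv assms(2) by auto
  qed
  ultimately show thesis using uv assms(2) by (intro that[of "(l, r)"]) (auto simp: solid_def)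
qed

lemma gap_solid_disjoint:
  assumes "gap K \<beta> \<or> solid K \<beta>" "gap K \<gamma> \<or> solid K \<gamma>" "\<beta> \<noteq> \<gamma>"
  shows "snd \<beta> \<le> fst \<gamma> \<or> snd \<gamma> \<le> fst \<beta>"
proof -
  have gg: "snd \<beta> \<le> fst \<gamma> \<or> snd \<gamma> \<le> fst \<beta>" if "gap K \<beta>" "gap K \<gamma>" "\<beta> \<noteq> \<gamma>" for \<beta> \<gamma>
  proof -
    have "fst \<gamma> \<notin> {fst \<beta><..<snd \<beta>}" "snd \<gamma> \<notin> {fst \<beta><..<snd \<beta>}"
      "fst \<beta> \<notin> {fst \<gamma><..<snd \<gamma>}" "snd \<beta> \<notin> {fst \<gamma><..<snd \<gamma>}" "fst \<beta> < snd \<beta>" "fst \<gamma> < snd \<gamma>"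
      using that unfolding gap_def by blast+
    moreover have "fst \<beta> \<noteq> fst \<gamma> \<or> snd \<beta> \<noteq> snd \<gamma>" using that(3) by (simp add: prod_eq_iff)
    ultimately show ?thesis by auto
  qed
  have gs: "snd \<beta> \<le> fst \<gamma> \<or> snd \<gamma> \<le> fst \<beta>" if "gap K \<beta>" "solid K \<gamma>" for \<beta> \<gamma>
  proof (rule ccontr)
    assume "\<not> ?thesis"
    then have "max (fst \<beta>) (fst \<gamma>) < min (snd \<beta>) (snd \<gamma>)"
      using that by (auto simp: gap_def solid_def)
    from Orderings.dense[OF this] obtain z where "z \<in> {fst \<beta><..<snd \<beta>}" "z \<in> {fst \<gamma>..snd \<gamma>}" by auto
    then show False using that unfolding gap_def solid_def by blast
  qed
  have ss: "snd \<beta> \<le> fst \<gamma> \<or> snd \<gamma> \<le> fst \<beta>" if "solid K \<beta>" "solid K \<gamma>" "\<beta> \<noteq> \<gamma>" for \<beta> \<gamma>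
  proof (rule ccontr)
    assume overlap: "\<not> ?thesis"
    have "{min (fst \<beta>) (fst \<gamma>)..max (snd \<beta>) (snd \<gamma>)} \<subseteq> {fst \<beta>..snd \<beta>} \<union> {fst \<gamma>..snd \<gamma>}"
      using overlap by auto
    also have "\<dots> \<subseteq> K" using that by (auto simp: solid_def)
    finally have "\<beta> = \<gamma>" using that(1,2) unfolding solid_def prod_eq_iff
      by (metis max.cobounded1 max.cobounded2 min.cobounded1 min.cobounded2)
    then show False using that(3) by blast
  qed
  show ?thesis using assms gg gs ss by metis
qed

lemma compact_hull:
  fixes K :: "real set"
  assumes "compact K" "K \<noteq> {}"
  shows "Inf K \<in> K" "Sup K \<in> K" "K \<subseteq> {Inf K..Sup K}"
proof -
  have bdd: "bdd_above K" "bdd_below K"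
    using compact_imp_bounded[OF assms(1)] by (simp_all add: bounded_imp_bdd_above bounded_imp_bdd_below)
  show "Inf K \<in> K" "Sup K \<in> K"
    using closed_contains_Inf closed_contains_Sup bdd assms compact_imp_closed by blast+
  show "K \<subseteq> {Inf K..Sup K}" using bdd by (auto intro: cInf_lower cSup_upper)
qed

lemma compact_eq_hull_minus_gaps:
  assumes "compact K" "K \<noteq> {}"
  shows "K = {Inf K..Sup K} - (\<Union>\<beta>\<in>{\<beta>. gap K \<beta>}. {fst \<beta><..<snd \<beta>})"
proof (intro equalityI subsetI)
  fix z assume "z \<in> K"
  then show "z \<in> {Inf K..Sup K} - (\<Union>\<beta>\<in>{\<beta>. gap K \<beta>}. {fst \<beta><..<snd \<beta>})"
    using compact_hull(3)[OF assms] unfolding gap_def by blast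
next
  fix z assume z: "z \<in> {Inf K..Sup K} - (\<Union>\<beta>\<in>{\<beta>. gap K \<beta>}. {fst \<beta><..<snd \<beta>})"
  show "z \<in> K"
  proof (rule ccontr)
    assume "z \<notin> K"
    then have "Inf K < z" "z < Sup K" using z compact_hull[OF assms] by (auto simp: less_le)
    then obtain \<beta> where "gap K \<beta>" "fst \<beta> < z" "z < snd \<beta>"
      using gap_exists[OF compact_imp_closed[OF assms(1)] compact_hull(1,2)[OF assms]] \<open>z \<notin> K\<close> by metis
    then show False using z by auto
  qed
qed

text \<open>
  One colour suffices: the blocks are the gaps. Since an endpoint of a gap is not isolated, other points
  of \<open>K\<close> accumulate at it from the side away from the gap, and any two of them are separated by a gap.
\<close>
lemma cantor_set_criterion:
  assumes K: "compact K" "K \<noteq> {}"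
    and perfect: "\<And>p e. p \<in> K \<Longrightarrow> 0 < e \<Longrightarrow> \<exists>q\<in>K. q \<noteq> p \<and> \<bar>q - p\<bar> < e"
    and thin: "\<And>u v. u < v \<Longrightarrow> \<exists>z. u < z \<and> z < v \<and> z \<notin> K"
  shows "cantor_set K"
proof -
  note hull = compact_hull[OF K]
  note gaps = gap_exists[OF compact_imp_closed[OF K(1)]]
  define B where "B = {\<beta>. gap K \<beta>}"
  have "accumulating_blocks (Inf K) (Sup K) B (\<lambda>_. True) (\<lambda>_. True)"
  proof
    show "Inf K < Sup K"
    proof -
      obtain q where "q \<in> K" "q \<noteq> Inf K" using perfect[OF hull(1), of 1] by auto
      then show ?thesis using hull by (metis atLeastAtMost_iff less_le order_trans order_antisym subsetD)
    qed
  next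
    fix \<beta> assume "\<beta> \<in> B"
    then show "Inf K \<le> fst \<beta> \<and> fst \<beta> < snd \<beta> \<and> snd \<beta> \<le> Sup K"
      using hull(3) by (auto simp: B_def gap_def)
  next
    fix \<beta> \<gamma> assume "\<beta> \<in> B" "\<gamma> \<in> B" "\<beta> \<noteq> \<gamma>"
    then show "snd \<beta> \<le> fst \<gamma> \<or> snd \<gamma> \<le> fst \<beta>" using gap_solid_disjoint[of K \<beta> \<gamma>] by (simp add: B_def)
  next
    fix p e :: real and n :: nat assume p: "p \<in> insert (Inf K) (snd ` B)" and e: "0 < e"
    have "\<exists>d>0. K \<inter> {p-d<..<p} = {}"
    proof (cases "p = Inf K")
      case True then show ?thesis using hull(3) by (intro exI[of _ 1]) auto
    next
      case False
      then obtain \<beta> where "gap K \<beta>" "p = snd \<beta>" using p by (auto simp: B_def)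
      then show ?thesis by (intro exI[of _ "p - fst \<beta>"]) (auto simp: gap_def)
    qed
    then obtain d where d: "d > 0" "K \<inter> {p-d<..<p} = {}" by blast
    have pK: "p \<in> K" using p hull(1) by (auto simp: B_def gap_def)
    have near: "\<exists>q\<in>K. p < q \<and> q < p + e'" if e': "0 < e'" for e'
    proof -
      obtain q where "q \<in> K" "q \<noteq> p" "\<bar>q - p\<bar> < min d e'" using perfect[OF pK, of "min d e'"] d e' by auto
      then show ?thesis using d(2) by (intro bexI[of _ q]) (auto simp: abs_if split: if_splits)
    qed
    obtain q where q: "q \<in> K" "p < q" "q < p + e" using near[OF e] by blast
    obtain q' where q': "q' \<in> K" "p < q'" "q' < q" using near[of "q - p"] q(2) by auto
    obtain z where "q' < z" "z < q" "z \<notin> K" using thin[OF q'(3)] by blast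
    from gaps[OF q'(1) q(1) this] obtain \<beta> where "gap K \<beta>" "q' \<le> fst \<beta>" "snd \<beta> \<le> q" by metis
    then show "\<exists>\<beta>\<in>B. True = True \<and> p < fst \<beta> \<and> snd \<beta> < p + e"
      using q q' by (intro bexI[of _ \<beta>]) (auto simp: B_def)
  next
    fix p e :: real and n :: nat assume p: "p \<in> insert (Sup K) (fst ` B)" and e: "0 < e"
    have "\<exists>d>0. K \<inter> {p<..<p+d} = {}"
    proof (cases "p = Sup K")
      case True then show ?thesis using hull(3) by (intro exI[of _ 1]) auto
    next
      case False
      then obtain \<beta> where "gap K \<beta>" "p = fst \<beta>" using p by (auto simp: B_def)
      then show ?thesis by (intro exI[of _ "snd \<beta> - p"]) (auto simp: gap_def)
    qed
    then obtain d where d: "d > 0" "K \<inter> {p<..<p+d} = {}" by blast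
    have pK: "p \<in> K" using p hull(2) by (auto simp: B_def gap_def)
    have near: "\<exists>q\<in>K. p - e' < q \<and> q < p" if e': "0 < e'" for e'
    proof -
      obtain q where "q \<in> K" "q \<noteq> p" "\<bar>q - p\<bar> < min d e'" using perfect[OF pK, of "min d e'"] d e' by auto
      then show ?thesis using d(2) by (intro bexI[of _ q]) (auto simp: abs_if split: if_splits)
    qed
    obtain q where q: "q \<in> K" "p - e < q" "q < p" using near[OF e] by blast
    obtain q' where q': "q' \<in> K" "q < q'" "q' < p" using near[of "p - q"] q(3) by auto
    obtain z where "q < z" "z < q'" "z \<notin> K" using thin[OF q'(2)] by blast
    from gaps[OF q(1) q'(1) this] obtain \<beta> where "gap K \<beta>" "q \<le> fst \<beta>" "snd \<beta> \<le> q'" by metis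
    then show "\<exists>\<beta>\<in>B. True = True \<and> p - e < fst \<beta> \<and> snd \<beta> < p"
      using q q' by (intro bexI[of _ \<beta>]) (auto simp: B_def)
  next
    fix u v assume uv: "Inf K \<le> u" "u < v" "v \<le> Sup K"
    obtain z where z: "u < z" "z < v" "z \<notin> K" using thin[OF uv(2)] by blast
    then obtain \<beta> where "gap K \<beta>" "fst \<beta> < z" "z < snd \<beta>" using gaps[OF hull(1,2) order_le_less_trans[OF uv(1) z(1)] order_less_le_trans[OF z(2) uv(3)] z(3)] by metis
    then show "\<exists>\<beta>\<in>B. fst \<beta> < v \<and> u < snd \<beta>" using z by (intro bexI[of _ \<beta>]) (auto simp: B_def)
  qed simp
  then interpret accumulating_blocks "Inf K" "Sup K" B "\<lambda>_. True" "\<lambda>_. True" .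
  have "(\<Union>n. G (Suc n)) = (\<Union>n\<in>{1..}. G n)"
  proof -
    have "{1..} = range Suc" by (auto simp: image_iff Suc_le_eq gr0_conv_Suc)
    then show ?thesis by simp
  qed
  then have "{0..1} - (\<Union>n\<in>{n::nat. True}. G (Suc n)) = middle_third_cantor"
    by (simp add: middle_third_cantor_def)
  moreover have "{Inf K..Sup K} - (\<Union>\<beta>\<in>{\<beta>\<in>B. True}. {fst \<beta><..<snd \<beta>}) = K"
    using compact_eq_hull_minus_gaps[OF K] by (simp add: B_def)
  ultimately show ?thesis
    using homeomorphic_cantor_tree[of "\<lambda>_. True"] unfolding cantor_set_def by simp
qed

text \<open>
  The points of \<open>K\<close> with a hole immediately to one side: endpoints of gaps and the extreme points of \<open>K\<close>.
\<close>
definition exposed_left :: "real set \<Rightarrow> real \<Rightarrow> bool" where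
  "exposed_left K p \<longleftrightarrow> p \<in> K \<and> (\<exists>d>0. {p-d<..<p} \<inter> K = {})"

definition exposed_right :: "real set \<Rightarrow> real \<Rightarrow> bool" where
  "exposed_right K p \<longleftrightarrow> p \<in> K \<and> (\<exists>d>0. {p<..<p+d} \<inter> K = {})"

text \<open>
  A condition that mentions only the exposed points, and so can be verified from the local shape of \<open>K\<close>. For
  the ends of interval components the same accumulation follows.
\<close>
definition cantorval_like :: "real set \<Rightarrow> bool" where
  "cantorval_like K \<longleftrightarrow> compact K \<and> K \<noteq> {} \<and> K \<subseteq> closure (interior K) \<and>
     (\<forall>p e. exposed_left K p \<longrightarrow> 0 < e \<longrightarrow> (\<exists>z. p < z \<and> z < p + e \<and> z \<notin> K)) \<and>
     (\<forall>p e. exposed_right K p \<longrightarrow> 0 < e \<longrightarrow> (\<exists>z. p - e < z \<and> z < p \<and> z \<notin> K))"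

lemma uminus_image_iff: "(z :: real) \<in> uminus ` K \<longleftrightarrow> - z \<in> K"
  by (force simp: image_iff intro!: bexI[of _ "- z"])

lemma exposed_uminus:
  "exposed_left (uminus ` K) p \<longleftrightarrow> exposed_right K (- p)"
  "exposed_right (uminus ` K) p \<longleftrightarrow> exposed_left K (- p)"
proof -
  have "{p-d<..<p} \<inter> uminus ` K = uminus ` ({-p<..<-p+d} \<inter> K)"
    "{p<..<p+d} \<inter> uminus ` K = uminus ` ({-p-d<..<-p} \<inter> K)" for d
    by (simp_all add: image_Int add.commute)
  then show "exposed_left (uminus ` K) p \<longleftrightarrow> exposed_right K (- p)"
    "exposed_right (uminus ` K) p \<longleftrightarrow> exposed_left K (- p)"
    by (simp_all add: exposed_left_def exposed_right_def uminus_image_iff)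
qed

text \<open>
  Reflection lets every statement about right endpoints yield the one about left endpoints.
\<close>
lemma cantorval_like_uminus:
  assumes "cantorval_like K"
  shows "cantorval_like (uminus ` K)"
  unfolding cantorval_like_def
proof (intro conjI allI impI)
  show "compact (uminus ` K)" using assms by (simp add: cantorval_like_def compact_negations)
  show "uminus ` K \<subseteq> closure (interior (uminus ` K))"
  proof -
    have "uminus ` K \<subseteq> uminus ` closure (interior K)" using assms by (auto simp: cantorval_like_def)
    also have "\<dots> = closure (uminus ` interior K)"
      by (intro closure_injective_linear_image) (auto simp: linear_uminus)
    finally show ?thesis by (simp add: interior_negations)
  qed
  show "uminus ` K \<noteq> {}" using assms by (simp add: cantorval_like_def)
next
  fix p e :: real assume "exposed_left (uminus ` K) p" "0 < e"
  then obtain z where "- p - e < z \<and> z < - p \<and> z \<notin> K"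
    using assms unfolding exposed_uminus cantorval_like_def by blast
  then show "\<exists>z. p < z \<and> z < p + e \<and> z \<notin> uminus ` K"
    by (intro exI[of _ "- z"]) (auto simp: uminus_image_iff)
next
  fix p e :: real assume "exposed_right (uminus ` K) p" "0 < e"
  then obtain z where "- p < z \<and> z < - p + e \<and> z \<notin> K"
    using assms unfolding exposed_uminus cantorval_like_def by blast
  then show "\<exists>z. p - e < z \<and> z < p \<and> z \<notin> uminus ` K"
    by (intro exI[of _ "- z"]) (auto simp: uminus_image_iff)
qed

lemma gap_uminus:
  assumes "gap K (l, r)"
  shows "gap (uminus ` K) (- r, - l)"
  using assms by (auto simp: gap_def)

lemma solid_uminus:
  assumes "solid K (l, r)"
  shows "solid (uminus ` K) (- r, - l)"
proof -
  have "u = - r \<and> v = - l" if "u \<le> - r" "- l \<le> v" "{u..v} \<subseteq> uminus ` K" for u v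
  proof -
    have "{-v..-u} \<subseteq> K"
    proof
      fix t assume "t \<in> {-v..-u}"
      then have "- t \<in> {u..v}" by auto
      then show "t \<in> K" using that(3) by auto
    qed
    moreover have "- v \<le> l" "r \<le> - u" using that by auto
    ultimately have "- v = l \<and> - u = r" using assms unfolding solid_def fst_conv snd_conv by blast
    then show ?thesis by auto
  qed
  moreover have "{-r..-l} \<subseteq> uminus ` K"
    using assms by (force simp: solid_def uminus_image_iff)
  ultimately show ?thesis using assms by (auto simp: solid_def)
qed

text \<open>
  At an exposed point, interior points of \<open>K\<close> are close, and they cannot lie on the exposed side, so they and the
  holes both accumulate from the right. At the right end \<open>p\<close> of a component, maximality gives holes to
  the right of \<open>p\<close>. If \<open>p\<close> itself were the left end of a gap, holes would accumulate at it from the left,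
  inside the component. So \<open>K\<close> continues to accumulate from the right, and with it the interior of \<open>K\<close>.
\<close>
lemma cantorval_like_right:
  assumes "cantorval_like K" "exposed_left K p \<or> (\<exists>l. solid K (l, p))" "0 < e"
  shows "\<exists>\<beta>. gap K \<beta> \<and> p < fst \<beta> \<and> snd \<beta> < p + e" "\<exists>\<beta>. solid K \<beta> \<and> p < fst \<beta> \<and> snd \<beta> < p + e"
proof -
  have K: "compact K" "K \<noteq> {}" "K \<subseteq> closure (interior K)" "closed K"
    and holes_right: "\<And>p e. exposed_left K p \<Longrightarrow> 0 < e \<Longrightarrow> \<exists>z. p < z \<and> z < p + e \<and> z \<notin> K"
    and holes_left: "\<And>p e. exposed_right K p \<Longrightarrow> 0 < e \<Longrightarrow> \<exists>z. p - e < z \<and> z < p \<and> z \<notin> K"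
    using assms(1) compact_imp_closed unfolding cantorval_like_def by blast+
  note hull = compact_hull[OF K(1,2)]
  have approx: "\<exists>w\<in>interior K. u < w \<and> w < v" if "t \<in> K" "u < t" "t < v" for t u v
  proof -
    have "{u<..<v} \<inter> interior K \<noteq> {}"
      using that K(3) open_Int_closure_eq_empty[of "{u<..<v}" "interior K"] by auto
    then show ?thesis by auto
  qed
  have key: "(\<exists>z. p < z \<and> z < p + e \<and> z \<notin> K) \<and> (\<exists>w\<in>interior K. p < w \<and> w < p + e)" if e: "0 < e" for e
    using assms(2)
  proof
    assume p: "exposed_left K p"
    then obtain d where d: "d > 0" "{p-d<..<p} \<inter> K = {}" "p \<in> K" by (auto simp: exposed_left_def)
    obtain w where w: "w \<in> interior K" "p - d < w" "w < p + e"
      using approx[OF d(3), of "p - d" "p + e"] d(1) e by auto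
    moreover have "p \<le> w" using w d(2) interior_subset[of K] by (meson disjoint_iff greaterThanLessThan_iff not_le subsetD)
    moreover have "w \<noteq> p"
    proof
      assume "w = p"
      then obtain c where "c > 0" "ball p c \<subseteq> K" using w(1) by (meson mem_interior)
      then have "p - min c d / 2 \<in> K" using d(1) by (auto simp: subset_iff dist_real_def)
      moreover have "p - min c d / 2 \<in> {p-d<..<p}" using d(1) \<open>c > 0\<close> by auto
      ultimately show False using d(2) by blast
    qed
    ultimately show ?thesis using holes_right[OF p e] by (intro conjI bexI[of _ w]) auto
  next
    assume "\<exists>l. solid K (l, p)"
    then obtain l where l: "l < p" "{l..p} \<subseteq> K" and maximal: "\<And>v. p \<le> v \<Longrightarrow> {l..v} \<subseteq> K \<Longrightarrow> v = p"
      unfolding solid_def by fastforce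
    have not_exposed: "\<not> exposed_right K p"
    proof
      assume "exposed_right K p"
      then obtain z where "p - (p - l) < z" "z < p" "z \<notin> K" using holes_left[of p "p - l"] l(1) by auto
      then have "z \<in> {l..p}" by simp
      then show False using l(2) \<open>z \<notin> K\<close> by blast
    qed
    obtain z where z: "p < z" "z < p + e" "z \<notin> K"
    proof -
      have "\<not> {l..p + e / 2} \<subseteq> K" using maximal[of "p + e / 2"] e by auto
      then obtain t where "l \<le> t" "t \<le> p + e / 2" "t \<notin> K" by (meson atLeastAtMost_iff subsetI)
      moreover have "p < t" using calculation l(2) by (meson atLeastAtMost_iff not_le subsetD)
      ultimately show thesis using e by (intro that[of t]) auto
    qed
    have "p \<in> K" using l by auto
    then have "{p<..<p + (z - p)} \<inter> K \<noteq> {}"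
      using not_exposed z(1) unfolding exposed_right_def by (metis diff_gt_0_iff_gt)
    then obtain t where t: "t \<in> K" "p < t" "t < z" by auto
    then obtain w where "w \<in> interior K" "p < w" "w < z" using approx[of t p z] by blast
    then show ?thesis using z by (intro conjI exI[of _ z] bexI[of _ w]) auto
  qed
  \<comment> \<open>Interior points and holes are picked in turn, approaching p:
    p < z' < w' < z < w. A gap is found around z, and a component around w' that z' and z enclose.\<close>
  obtain w where w: "w \<in> interior K" "p < w" "w < p + e" using key[OF assms(3)] by blast
  obtain z where z: "p < z" "z < w" "z \<notin> K" using key[of "w - p"] w(2) by auto
  obtain w' where w': "w' \<in> interior K" "p < w'" "w' < z" using key[of "z - p"] z(1) by auto
  obtain \<beta> where \<beta>: "gap K \<beta>" "w' \<le> fst \<beta>" "fst \<beta> < z" "z < snd \<beta>" "snd \<beta> \<le> w"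
    using gap_exists[OF K(4), of w' w z] w w' z interior_subset[of K] by (metis subsetD)
  then show "\<exists>\<beta>. gap K \<beta> \<and> p < fst \<beta> \<and> snd \<beta> < p + e" using w w' by (intro exI[of _ \<beta>]) auto
  obtain z' where z': "p < z'" "z' < w'" "z' \<notin> K" using key[of "w' - p"] w'(2) by auto
  obtain c where c: "c > 0" "cball w' c \<subseteq> K" using w'(1) by (meson mem_interior_cball)
  then have "{w'..w'+c} \<subseteq> K" "w' < w' + c" by (auto simp: subset_iff dist_real_def)
  then obtain \<gamma> where \<gamma>: "solid K \<gamma>" "fst \<gamma> \<le> w'" "w' + c \<le> snd \<gamma>" using solid_exists[OF K(1)] by metis
  have "p < fst \<gamma>"
  proof (rule ccontr)
    assume "\<not> ?thesis"
    then have "z' \<in> {fst \<gamma>..snd \<gamma>}" using \<gamma> z' c(1) by auto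
    then show False using \<gamma>(1) z'(3) unfolding solid_def by blast
  qed
  moreover have "snd \<gamma> < z"
  proof (rule ccontr)
    assume "\<not> ?thesis"
    then have "z \<in> {fst \<gamma>..snd \<gamma>}" using \<gamma> w'(3) by auto
    then show False using \<gamma>(1) z(3) unfolding solid_def by blast
  qed
  ultimately show "\<exists>\<beta>. solid K \<beta> \<and> p < fst \<beta> \<and> snd \<beta> < p + e"
    using \<gamma>(1) z(2) w(3) by (intro exI[of _ \<gamma>]) auto
qed

lemma cantorval_like_left:
  assumes "cantorval_like K" "exposed_right K p \<or> (\<exists>r. solid K (p, r))" "0 < e"
  shows "\<exists>\<beta>. gap K \<beta> \<and> p - e < fst \<beta> \<and> snd \<beta> < p" "\<exists>\<beta>. solid K \<beta> \<and> p - e < fst \<beta> \<and> snd \<beta> < p"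
proof -
  have inv: "uminus ` uminus ` K = K" by (simp add: image_image)
  have "exposed_left (uminus ` K) (- p) \<or> (\<exists>l. solid (uminus ` K) (l, - p))"
    using assms(2) solid_uminus unfolding exposed_uminus by auto
  note mirror = cantorval_like_right[OF cantorval_like_uminus[OF assms(1)] this assms(3)]
  obtain l r where 1: "gap (uminus ` K) (l, r)" "- p < l" "r < - p + e" using mirror(1) by auto
  show "\<exists>\<beta>. gap K \<beta> \<and> p - e < fst \<beta> \<and> snd \<beta> < p"
    using gap_uminus[OF 1(1)] 1(2,3) unfolding inv by (intro exI[of _ "(- r, - l)"]) auto
  obtain l r where 2: "solid (uminus ` K) (l, r)" "- p < l" "r < - p + e" using mirror(2) by auto
  show "\<exists>\<beta>. solid K \<beta> \<and> p - e < fst \<beta> \<and> snd \<beta> < p"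
    using solid_uminus[OF 2(1)] 2(2,3) unfolding inv by (intro exI[of _ "(- r, - l)"]) auto
qed

text \<open>
  The blocks are the gaps and the interval components. In the model the thirds of odd depth (counted from \<open>0\<close>) are the
  removed ones, so gaps have to sit at odd and components at even depth of the tree.
\<close>
lemma cantorval_criterion:
  assumes "cantorval_like K"
  shows "cantorval K"
proof -
  have K: "compact K" "K \<noteq> {}" using assms unfolding cantorval_like_def by blast+
  note hull = compact_hull[OF K]
  note gaps = gap_exists[OF compact_imp_closed[OF K(1)]]
  define B where "B = {\<beta>. gap K \<beta> \<or> solid K \<beta>}"
  have not_both: "\<not> gap K \<beta>" if "solid K \<beta>" for \<beta>
  proof
    assume "gap K \<beta>"
    then have "(fst \<beta> + snd \<beta>) / 2 \<in> {fst \<beta><..<snd \<beta>}" "(fst \<beta> + snd \<beta>) / 2 \<in> {fst \<beta>..snd \<beta>}"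
      by (auto simp: gap_def)
    then show False using that \<open>gap K \<beta>\<close> unfolding gap_def solid_def by blast
  qed
  have hull_ends: "exposed_left K (Inf K)" "exposed_right K (Sup K)"
    using hull by (auto simp: exposed_left_def exposed_right_def intro!: exI[of _ 1])
  have gap_ends: "exposed_left K (snd \<beta>)" "exposed_right K (fst \<beta>)" if "gap K \<beta>" for \<beta>
    using that by (auto simp: exposed_left_def exposed_right_def gap_def intro!: exI[of _ "snd \<beta> - fst \<beta>"])
  have right_end: "exposed_left K p \<or> (\<exists>l. solid K (l, p))" if "p \<in> insert (Inf K) (snd ` B)" for p
    using that hull_ends gap_ends by (auto simp: B_def)
  have left_end: "exposed_right K q \<or> (\<exists>r. solid K (q, r))" if "q \<in> insert (Sup K) (fst ` B)" for q
    using that hull_ends gap_ends by (auto simp: B_def)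
  have "accumulating_blocks (Inf K) (Sup K) B (gap K) odd"
  proof
    obtain \<beta> where "gap K \<beta>" using cantorval_like_right(1)[OF assms right_end, of "Inf K" 1] by auto
    then have "fst \<beta> \<in> {Inf K..Sup K}" "snd \<beta> \<in> {Inf K..Sup K}" "fst \<beta> < snd \<beta>"
      using hull(3) unfolding gap_def by blast+
    then show "Inf K < Sup K" by auto
  next
    fix \<beta> assume "\<beta> \<in> B"
    then show "Inf K \<le> fst \<beta> \<and> fst \<beta> < snd \<beta> \<and> snd \<beta> \<le> Sup K"
      using hull(3) by (force simp: B_def gap_def solid_def subset_iff)
  next
    fix \<beta> \<gamma> assume "\<beta> \<in> B" "\<gamma> \<in> B" "\<beta> \<noteq> \<gamma>"
    then show "snd \<beta> \<le> fst \<gamma> \<or> snd \<gamma> \<le> fst \<beta>" using gap_solid_disjoint[of K] by (simp add: B_def)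
  next
    fix p e :: real and n :: nat assume p: "p \<in> insert (Inf K) (snd ` B)" and e: "0 < e"
    show "\<exists>\<beta>\<in>B. gap K \<beta> = odd n \<and> p < fst \<beta> \<and> snd \<beta> < p + e"
      using cantorval_like_right[OF assms right_end[OF p] e] not_both
      unfolding B_def by (cases "odd n") blast+
  next
    fix q e :: real and n :: nat assume q: "q \<in> insert (Sup K) (fst ` B)" and e: "0 < e"
    show "\<exists>\<beta>\<in>B. gap K \<beta> = odd n \<and> q - e < fst \<beta> \<and> snd \<beta> < q"
      using cantorval_like_left[OF assms left_end[OF q] e] not_both
      unfolding B_def by (cases "odd n") blast+
  next
    fix u v assume uv: "Inf K \<le> u" "u < v" "v \<le> Sup K"
    show "\<exists>\<beta>\<in>B. fst \<beta> < v \<and> u < snd \<beta>"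
    proof (cases "{u<..<v} \<subseteq> K")
      case True
      have "{(2 * u + v) / 3..(u + 2 * v) / 3} \<subseteq> K" using uv(2) by (intro order_trans[OF _ True]) auto
      then obtain \<beta> where "solid K \<beta>" "fst \<beta> \<le> (2 * u + v) / 3" "(u + 2 * v) / 3 \<le> snd \<beta>"
        using solid_exists[OF K(1), of "(2 * u + v) / 3" "(u + 2 * v) / 3"] uv(2) by auto
      then show ?thesis using uv(2) by (intro bexI[of _ \<beta>]) (auto simp: B_def)
    next
      case False
      then obtain z where z: "u < z" "z < v" "z \<notin> K" by (meson greaterThanLessThan_iff subsetI)
      then obtain \<beta> where "gap K \<beta>" "fst \<beta> < z" "z < snd \<beta>" using gaps[OF hull(1,2) order_le_less_trans[OF uv(1) z(1)] order_less_le_trans[OF z(2) uv(3)] z(3)] by metis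
      then show ?thesis using z by (intro bexI[of _ \<beta>]) (auto simp: B_def)
    qed
  next
    fix \<beta> assume "\<beta> \<in> B"
    have "infinite {n :: nat. odd n = c}" for c
      unfolding infinite_nat_iff_unbounded
    proof
      fix m :: nat
      show "\<exists>n>m. n \<in> {n. odd n = c}"
        by (rule exI[of _ "if odd (Suc m) = c then Suc m else Suc (Suc m)"]) auto
    qed
    then show "infinite {n :: nat. odd n = gap K \<beta>}" .
  qed
  then interpret accumulating_blocks "Inf K" "Sup K" B "gap K" odd .
  have "{0..1} - (\<Union>n\<in>{n. odd n}. G (Suc n)) = middle_third_cantor \<union> (\<Union>n\<in>{1..}. G (2 * n - 1))"
    (is "?L = ?R")
  proof (intro equalityI subsetI)
    fix z assume z: "z \<in> ?L"
    show "z \<in> ?R"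
    proof (cases "z \<in> middle_third_cantor")
      case False
      then obtain m where m: "m \<ge> 1" "z \<in> G m" using z by (auto simp: middle_third_cantor_def)
      then obtain k where k: "m = Suc k" by (cases m) auto
      then have "even k" using z m(2) by blast
      then have "m = 2 * Suc (k div 2) - 1" using k by auto
      moreover have "Suc (k div 2) \<in> {1..}" by simp
      ultimately show ?thesis using m(2) by blast
    qed simp
  next
    fix z assume "z \<in> ?R"
    then consider "z \<in> middle_third_cantor" | n where "n \<ge> 1" "z \<in> G (2 * n - 1)" by auto
    then show "z \<in> ?L"
    proof cases
      case 1
      then show ?thesis by (auto simp: middle_third_cantor_def)
    next
      case 2
      have "z \<notin> G (Suc m)" if "odd m" for m
      proof -
        have "2 * n - 1 \<noteq> Suc m" using that 2(1) by presburger
        moreover have "2 * n - 1 \<ge> 1" using 2(1) by simp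
        ultimately have "G (2 * n - 1) \<inter> G (Suc m) = {}" by (intro G_disjoint) auto
        then show ?thesis using 2(2) by blast
      qed
      moreover have "G (2 * n - 1) \<subseteq> {0..1}" using 2(1) by (intro G_subset) simp
      ultimately show ?thesis using 2(2) by blast
    qed
  qed
  moreover have "{Inf K..Sup K} - (\<Union>\<beta>\<in>{\<beta>\<in>B. gap K \<beta>}. {fst \<beta><..<snd \<beta>}) = K"
  proof -
    have "{\<beta>\<in>B. gap K \<beta>} = {\<beta>. gap K \<beta>}" by (auto simp: B_def)
    then show ?thesis using compact_eq_hull_minus_gaps[OF K] by simp
  qed
  ultimately show ?thesis
    using homeomorphic_cantor_tree[of "\<lambda>c. c"] unfolding cantorval_def by simp
qed

section \<open>Self-similarity of the set of subsums\<close>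

definition digits :: "nat \<Rightarrow> nat \<Rightarrow> nat set" where
  "digits x y = {0, x, y, x + y}"

lemma E_I: "(\<And>n. \<epsilon> n \<in> digits x y) \<Longrightarrow> (\<Sum>n. real (\<epsilon> n) / 4 ^ Suc n) \<in> E x y"
  unfolding E_def digits_def by blast

lemma E_E:
  assumes "z \<in> E x y"
  obtains \<epsilon> where "z = (\<Sum>n. real (\<epsilon> n) / 4 ^ Suc n)" "\<And>n. \<epsilon> n \<in> digits x y"
  using assms unfolding E_def digits_def by blast

lemma finite_digits [simp]: "finite (digits x y)"
  by (simp add: digits_def)

lemma base4_series:
  fixes \<epsilon> :: "nat \<Rightarrow> nat"
  assumes "\<And>n. \<epsilon> n \<le> M"
  shows "summable (\<lambda>n. real (\<epsilon> n) / 4 ^ Suc n)" "0 \<le> (\<Sum>n. real (\<epsilon> n) / 4 ^ Suc n)"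
    "(\<Sum>n. real (\<epsilon> n) / 4 ^ Suc n) \<le> real M / 3"
proof -
  have geo: "(\<lambda>n. real M / 4 ^ Suc n) sums (real M / 3)"
    using sums_mult[OF geometric_sums[of "1/4 :: real"], of "real M / 4"]
    by (simp add: power_one_over field_simps)
  have le: "real (\<epsilon> n) / 4 ^ Suc n \<le> real M / 4 ^ Suc n" for n
    using assms by (intro divide_right_mono) auto
  show s: "summable (\<lambda>n. real (\<epsilon> n) / 4 ^ Suc n)"
    using le by (intro summable_comparison_test[OF _ sums_summable[OF geo]]) auto
  show "0 \<le> (\<Sum>n. real (\<epsilon> n) / 4 ^ Suc n)" by (intro suminf_nonneg s) auto
  show "(\<Sum>n. real (\<epsilon> n) / 4 ^ Suc n) \<le> real M / 3"
    using suminf_le[OF le s sums_summable[OF geo]] sums_unique[OF geo] by simp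
qed

lemma base4_series_Cons:
  fixes \<epsilon> :: "nat \<Rightarrow> nat"
  assumes "\<And>n. \<epsilon> n \<le> M"
  shows "(\<Sum>n. real (\<epsilon> n) / 4 ^ Suc n) = (real (\<epsilon> 0) + (\<Sum>n. real (\<epsilon> (Suc n)) / 4 ^ Suc n)) / 4"
proof -
  have "(\<Sum>n. real (\<epsilon> n) / 4 ^ Suc n) = real (\<epsilon> 0) / 4 + (\<Sum>n. real (\<epsilon> (Suc n)) / 4 ^ Suc n / 4)"
    using suminf_split_head[OF base4_series(1)[of \<epsilon>, OF assms]] by (simp add: mult.commute)
  then show ?thesis
    using suminf_divide[OF base4_series(1)[of "\<lambda>n. \<epsilon> (Suc n)", OF assms], of 4] by (simp add: add_divide_distrib)
qed

lemma digit_le: "d \<in> digits x y \<Longrightarrow> d \<le> x + y"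
  by (auto simp: digits_def)

lemma E_commute: "E x y = E y x"
  unfolding E_def by (simp add: insert_commute add.commute)

lemma E_bounds: "e \<in> E x y \<Longrightarrow> 0 \<le> e" "e \<in> E x y \<Longrightarrow> e \<le> (real x + real y) / 3"
proof -
  have "0 \<le> e \<and> e \<le> (real x + real y) / 3" if that_E: "e \<in> E x y"
  proof -
    obtain \<epsilon> where "e = (\<Sum>n. real (\<epsilon> n) / 4 ^ Suc n)" "\<And>n. \<epsilon> n \<in> digits x y"
      using E_E[OF that_E] by blast
    then show ?thesis using base4_series(2,3)[of \<epsilon> "x + y"] digit_le by auto
  qed
  then show "e \<in> E x y \<Longrightarrow> 0 \<le> e" "e \<in> E x y \<Longrightarrow> e \<le> (real x + real y) / 3" by blast+
qed

lemma E_cons: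
  assumes "d \<in> digits x y" "e \<in> E x y"
  shows "(real d + e) / 4 \<in> E x y"
proof -
  obtain \<epsilon> where \<epsilon>: "e = (\<Sum>n. real (\<epsilon> n) / 4 ^ Suc n)" "\<And>n. \<epsilon> n \<in> digits x y"
    using E_E[OF assms(2)] by blast
  define \<delta> where "\<delta> = case_nat d \<epsilon>"
  have \<delta>: "\<delta> n \<in> digits x y" for n using \<epsilon> assms(1) by (auto simp: \<delta>_def split: nat.split)
  have "(\<Sum>n. real (\<delta> n) / 4 ^ Suc n) = (real d + e) / 4"
    using base4_series_Cons[of \<delta>, OF digit_le[OF \<delta>]] \<epsilon>(1) by (simp add: \<delta>_def)
  then show ?thesis using E_I[of \<delta>, OF \<delta>] by metis
qed

lemma E_uncons:
  assumes "z \<in> E x y"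
  obtains d e where "d \<in> digits x y" "e \<in> E x y" "z = (real d + e) / 4"
proof -
  obtain \<epsilon> where \<epsilon>: "z = (\<Sum>n. real (\<epsilon> n) / 4 ^ Suc n)" "\<And>n. \<epsilon> n \<in> digits x y"
    using E_E[OF assms] by blast
  have "(\<Sum>n. real (\<epsilon> (Suc n)) / 4 ^ Suc n) \<in> E x y"
    by (rule E_I) (rule \<epsilon>(2))
  then show thesis
    using that[OF \<epsilon>(2)[of 0]] base4_series_Cons[of \<epsilon>, OF digit_le[OF \<epsilon>(2)]] \<epsilon>(1) by simp
qed

text \<open>
  Expanding \<open>z \<in> K\<close> digit by digit never leaves \<open>K\<close>. Boundedness makes the remainder, divided by \<open>4 ^ n\<close>,
  tend to \<open>0\<close>, so the digits found represent \<open>z\<close>.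
\<close>
lemma E_maximal:
  assumes bounded: "\<And>z. z \<in> K \<Longrightarrow> \<bar>z\<bar> \<le> M"
    and step: "\<And>z. z \<in> K \<Longrightarrow> \<exists>d\<in>digits x y. 4 * z - real d \<in> K"
  shows "K \<subseteq> E x y"
proof
  fix z assume "z \<in> K"
  obtain \<delta> where \<delta>: "\<And>z. z \<in> K \<Longrightarrow> \<delta> z \<in> digits x y \<and> 4 * z - real (\<delta> z) \<in> K" using step by metis
  define t where "t n = ((\<lambda>z. 4 * z - real (\<delta> z)) ^^ n) z" for n
  have t: "t n \<in> K" for n by (induction n) (use \<open>z \<in> K\<close> \<delta> in \<open>auto simp: t_def\<close>)
  have partial: "(\<Sum>k<n. real (\<delta> (t k)) / 4 ^ Suc k) = z - t n / 4 ^ n" for n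
    by (induction n) (auto simp: t_def field_simps)
  have "(\<lambda>n. t n / 4 ^ n) \<longlonglongrightarrow> 0"
  proof (rule Lim_null_comparison)
    show "\<forall>\<^sub>F n in sequentially. norm (t n / 4 ^ n) \<le> M * (1 / 4) ^ n"
      using bounded[OF t] by (auto simp: power_one_over divide_right_mono)
    show "(\<lambda>n. M * (1 / 4) ^ n) \<longlonglongrightarrow> 0" by (auto intro!: tendsto_eq_intros LIMSEQ_realpow_zero)
  qed
  from tendsto_diff[OF tendsto_const[of z] this]
  have "(\<lambda>n. real (\<delta> (t n)) / 4 ^ Suc n) sums z"
    unfolding sums_def partial by simp
  then have "z = (\<Sum>n. real (\<delta> (t n)) / 4 ^ Suc n)" by (simp add: sums_unique)
  then show "z \<in> E x y" using E_I[of "\<lambda>n. \<delta> (t n)" x y] \<delta>[OF t] by simp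
qed

text \<open>
  The closure of \<open>E x y\<close> satisfies the same self-similarity, so it is contained in \<open>E x y\<close> by maximality.
\<close>
lemma compact_E: "compact (E x y)"
proof -
  have bounded: "bounded (E x y)"
    by (rule bounded_subset[OF bounded_closed_interval[of 0 "(real x + real y) / 3"]])
      (use E_bounds in fastforce)
  then have c: "compact (closure (E x y))" by simp
  define U where "U = (\<Union>d\<in>digits x y. (\<lambda>e. (real d + e) / 4) ` closure (E x y))"
  have "compact U" unfolding U_def
    by (intro compact_UN compact_continuous_image c continuous_intros) auto
  moreover have "E x y \<subseteq> U"
  proof
    fix z assume "z \<in> E x y"
    then obtain d e where "d \<in> digits x y" "e \<in> E x y" "z = (real d + e) / 4" by (rule E_uncons)
    then show "z \<in> U" unfolding U_def using closure_subset[of "E x y"] by blast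
  qed
  ultimately have cl: "closure (E x y) \<subseteq> U" by (simp add: closure_minimal compact_imp_closed)
  obtain M where "\<And>z. z \<in> closure (E x y) \<Longrightarrow> norm z \<le> M"
    using compact_imp_bounded[OF c] by (auto simp: bounded_iff)
  then have "closure (E x y) \<subseteq> E x y"
  proof (intro E_maximal)
    fix z assume "z \<in> closure (E x y)"
    then obtain d e where "d \<in> digits x y" "e \<in> closure (E x y)" "z = (real d + e) / 4"
      using cl unfolding U_def by blast
    then have "4 * z - real d = e" by simp
    then show "\<exists>d\<in>digits x y. 4 * z - real d \<in> closure (E x y)" 
      using \<open>d \<in> digits x y\<close> \<open>e \<in> closure (E x y)\<close> by metis
  qed auto
  then show ?thesis using c closure_subset by (metis subset_antisym)
qed

lemma zero_in_E: "0 \<in> E x y"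
  using E_maximal[of "{0}" 0 x y] by (auto simp: digits_def)

lemma E_reflect: "e \<in> E x y \<Longrightarrow> (real x + real y) / 3 - e \<in> E x y"
proof -
  let ?K = "(\<lambda>e. (real x + real y) / 3 - e) ` E x y"
  have "?K \<subseteq> E x y"
  proof (rule E_maximal)
    show "\<bar>z\<bar> \<le> (real x + real y) / 3" if "z \<in> ?K" for z
    proof -
      from that obtain e where "e \<in> E x y" "z = (real x + real y) / 3 - e" by (rule imageE)
      then show ?thesis using E_bounds[of e x y] by linarith
    qed
  next
    fix z assume "z \<in> ?K"
    then obtain e where "e \<in> E x y" "z = (real x + real y) / 3 - e" by blast
    moreover from this(1) obtain d e' where d: "d \<in> digits x y" "e' \<in> E x y" "e = (real d + e') / 4"
      by (rule E_uncons)
    ultimately have "4 * z - real (x + y - d) = (real x + real y) / 3 - e'"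
      using digit_le[OF d(1)] by (simp add: of_nat_diff field_simps)
    moreover have "x + y - d \<in> digits x y" using d(1) by (auto simp: digits_def)
    ultimately show "\<exists>d\<in>digits x y. 4 * z - real d \<in> ?K" using d(2) by (metis image_eqI)
  qed
  then show "e \<in> E x y \<Longrightarrow> (real x + real y) / 3 - e \<in> E x y" by blast
qed

text \<open>
  The digits of \<open>x\<close> and of \<open>y\<close> are switched on and off independently. This separates the two scales: \<open>E 1 0\<close> is the set
  of subsums of the powers of \<open>1 / 4\<close>.
\<close>
lemma E_iff: "z \<in> E x y \<longleftrightarrow> (\<exists>u\<in>E 1 0. \<exists>v\<in>E 1 0. z = real x * u + real y * v)"
proof
  assume "z \<in> E x y"
  then obtain \<epsilon> where \<epsilon>: "z = (\<Sum>n. real (\<epsilon> n) / 4 ^ Suc n)" "\<And>n. \<epsilon> n \<in> digits x y"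
    using E_E by blast
  have "\<exists>a b. a \<in> digits 1 0 \<and> b \<in> digits 1 0 \<and> \<epsilon> n = x * a + y * b" for n
  proof -
    have "\<epsilon> n = x * 0 + y * 0 \<or> \<epsilon> n = x * 1 + y * 0 \<or> \<epsilon> n = x * 0 + y * 1 \<or> \<epsilon> n = x * 1 + y * 1"
      using \<epsilon>(2)[of n] by (auto simp: digits_def)
    moreover have "0 \<in> digits 1 0" "1 \<in> digits 1 0" by (auto simp: digits_def)
    ultimately show ?thesis by blast
  qed
  then obtain a b where ab: "\<And>n. a n \<in> digits 1 0" "\<And>n. b n \<in> digits 1 0" "\<And>n. \<epsilon> n = x * a n + y * b n" by metis
  have "a n \<le> 1" "b n \<le> 1" for n using ab(1,2)[of n] by (auto simp: digits_def)
  note s = base4_series(1)[of a, OF this(1)] base4_series(1)[of b, OF this(2)]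
  have "z = real x * (\<Sum>n. real (a n) / 4 ^ Suc n) + real y * (\<Sum>n. real (b n) / 4 ^ Suc n)"
    unfolding \<epsilon>(1) suminf_mult[OF s(1), symmetric] suminf_mult[OF s(2), symmetric]
      suminf_add[OF summable_mult[OF s(1)] summable_mult[OF s(2)]] ab(3)
    by (simp add: add_divide_distrib)
  moreover have "(\<Sum>n. real (a n) / 4 ^ Suc n) \<in> E 1 0" "(\<Sum>n. real (b n) / 4 ^ Suc n) \<in> E 1 0"
    using E_I[of a] E_I[of b] ab by auto
  ultimately show "\<exists>u\<in>E 1 0. \<exists>v\<in>E 1 0. z = real x * u + real y * v" by blast
next
  assume "\<exists>u\<in>E 1 0. \<exists>v\<in>E 1 0. z = real x * u + real y * v"
  moreover have "{real x * u + real y * v | u v. u \<in> E 1 0 \<and> v \<in> E 1 0} \<subseteq> E x y" (is "?K \<subseteq> _")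
  proof (rule E_maximal)
    fix z assume "z \<in> ?K"
    then obtain u v where uv: "u \<in> E 1 0" "v \<in> E 1 0" "z = real x * u + real y * v" by blast
    have "0 \<le> u" "u \<le> 1/3" "0 \<le> v" "v \<le> 1/3" using E_bounds[OF uv(1)] E_bounds[OF uv(2)] by auto
    then have "real x * u \<le> real x * (1/3)" "real y * v \<le> real y * (1/3)" "0 \<le> real x * u" "0 \<le> real y * v"
      by (simp_all only: mult_left_mono mult_nonneg_nonneg of_nat_0_le_iff)
    then show "\<bar>z\<bar> \<le> (real x + real y) / 3" unfolding uv(3) by auto
    obtain a u' where a: "a \<in> digits 1 0" "u' \<in> E 1 0" "u = (real a + u') / 4" using uv(1) by (rule E_uncons)
    obtain b v' where b: "b \<in> digits 1 0" "v' \<in> E 1 0" "v = (real b + v') / 4" using uv(2) by (rule E_uncons)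
    have "x * a + y * b \<in> digits x y" using a(1) b(1) by (auto simp: digits_def)
    moreover have "4 * z - real (x * a + y * b) = real x * u' + real y * v'"
      unfolding uv(3) a(3) b(3) by (simp add: field_simps)
    ultimately show "\<exists>d\<in>digits x y. 4 * z - real d \<in> ?K" using a(2) b(2) by blast
  qed
  ultimately show "z \<in> E x y" by blast
qed

text \<open>
  Multiplying \<open>y\<close> by \<open>4\<close> adds one more term, \<open>y\<close>, to the terms whose subsums form \<open>E x y\<close>.
\<close>
lemma E_shift: "E x (4 * y) = E x y \<union> (\<lambda>e. e + real y) ` E x y"
proof (intro equalityI subsetI)
  fix z assume "z \<in> E x (4 * y)"
  then obtain u v where uv: "u \<in> E 1 0" "v \<in> E 1 0" "z = real x * u + 4 * real y * v"
    by (auto simp: E_iff[of z])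
  obtain b v' where b: "b \<in> digits 1 0" "v' \<in> E 1 0" "v = (real b + v') / 4" using uv(2) by (rule E_uncons)
  have "real x * u + real y * v' \<in> E x y" using uv(1) b(2) by (auto simp: E_iff[of _ x])
  moreover have "z = real x * u + real y * v' + real y * real b" unfolding uv(3) b(3) by (simp add: field_simps)
  ultimately show "z \<in> E x y \<union> (\<lambda>e. e + real y) ` E x y" using b(1) by (auto simp: digits_def)
next
  have shift: "real x * u + real y * v + real y * real b \<in> E x (4 * y)"
    if "u \<in> E 1 0" "v \<in> E 1 0" "b \<in> digits 1 0" for u v b
  proof -
    have "(real b + v) / 4 \<in> E 1 0" by (rule E_cons[OF that(3,2)])
    moreover have "real x * u + real y * v + real y * real b = real x * u + real (4 * y) * ((real b + v) / 4)"
      by (simp add: field_simps)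
    ultimately show ?thesis using that(1) E_iff[of _ x "4 * y"] by blast
  qed
  fix z assume "z \<in> E x y \<union> (\<lambda>e. e + real y) ` E x y"
  then obtain u v where "u \<in> E 1 0" "v \<in> E 1 0" "z = real x * u + real y * v \<or> z = real x * u + real y * v + real y"
    by (auto simp: E_iff[of _ x])
  then show "z \<in> E x (4 * y)" using shift[of u v 0] shift[of u v 1] by (auto simp: digits_def)
qed

text \<open>
  The values of expansions of length \<open>n\<close> with weights \<open>1\<close>, \<open>4\<close>, and so on. As this is a set, coinciding
  expansions are counted once.
\<close>
primrec sums4 :: "nat \<Rightarrow> nat \<Rightarrow> nat \<Rightarrow> nat set" where
  "sums4 x y 0 = {0}"
| "sums4 x y (Suc n) = (\<lambda>(d, e). d + 4 * e) ` (digits x y \<times> sums4 x y n)"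

lemma finite_sums4 [simp]: "finite (sums4 x y n)"
  by (induction n) auto

lemma sums4_add: "sums4 x y (m + n) = (\<lambda>(d, e). d + 4 ^ m * e) ` (sums4 x y m \<times> sums4 x y n)"
proof (induction m)
  case 0
  show ?case by (auto simp: image_iff)
next
  case (Suc m)
  have "sums4 x y (Suc m + n) = {a + 4 * (d + 4 ^ m * e) | a d e.
      a \<in> digits x y \<and> d \<in> sums4 x y m \<and> e \<in> sums4 x y n}"
    unfolding add_Suc sums4.simps Suc by force
  also have "\<dots> = {(a + 4 * d) + 4 ^ Suc m * e | a d e.
      a \<in> digits x y \<and> d \<in> sums4 x y m \<and> e \<in> sums4 x y n}"
    by (simp add: distrib_left mult.assoc add.assoc)
  also have "\<dots> = (\<lambda>(d, e). d + 4 ^ Suc m * e) ` (sums4 x y (Suc m) \<times> sums4 x y n)"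
    unfolding sums4.simps by force
  finally show ?case .
qed

lemma sums4_bound: "d \<in> sums4 x y n \<Longrightarrow> 3 * d + (x + y) \<le> (x + y) * 4 ^ n"
proof (induction n arbitrary: d)
  case (Suc n)
  then obtain a e where d: "d = a + 4 * e" "a \<in> digits x y" "e \<in> sums4 x y n" by auto
  have "3 * e + (x + y) \<le> (x + y) * 4 ^ n" using Suc.IH[OF d(3)] .
  moreover have "(x + y) * 4 ^ Suc n = 4 * ((x + y) * 4 ^ n)" by simp
  ultimately show ?case using digit_le[OF d(2)] d(1) by presburger
qed auto

lemma E_level: "E x y = (\<Union>d\<in>sums4 x y n. (\<lambda>e. (real d + e) / 4 ^ n) ` E x y)"
proof (induction n)
  case 0
  show ?case by simp
next
  case (Suc n)
  show ?case
  proof (intro equalityI subsetI)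
    fix z assume "z \<in> E x y"
    then have "z \<in> (\<Union>d\<in>sums4 x y n. (\<lambda>e. (real d + e) / 4 ^ n) ` E x y)" using Suc by blast
    then obtain d e where d: "d \<in> sums4 x y n" "e \<in> E x y" "z = (real d + e) / 4 ^ n" by blast
    obtain a e' where a: "a \<in> digits x y" "e' \<in> E x y" "e = (real a + e') / 4" using d(2) by (rule E_uncons)
    have "a + 4 * d \<in> sums4 x y (Suc n)" using a(1) d(1) by force
    moreover have "z = (real (a + 4 * d) + e') / 4 ^ Suc n" unfolding d(3) a(3) by (simp add: field_simps)
    ultimately show "z \<in> (\<Union>d\<in>sums4 x y (Suc n). (\<lambda>e. (real d + e) / 4 ^ Suc n) ` E x y)"
      using a(2) by blast
  next
    fix z assume "z \<in> (\<Union>d\<in>sums4 x y (Suc n). (\<lambda>e. (real d + e) / 4 ^ Suc n) ` E x y)"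
    then obtain a d e' where a: "a \<in> digits x y" "d \<in> sums4 x y n" "e' \<in> E x y"
      "z = (real (a + 4 * d) + e') / 4 ^ Suc n" by auto
    have "z = (real d + (real a + e') / 4) / 4 ^ n" unfolding a(4) by (simp add: field_simps)
    moreover have "(real a + e') / 4 \<in> E x y" by (rule E_cons[OF a(1,3)])
    ultimately have "z \<in> (\<Union>d\<in>sums4 x y n. (\<lambda>e. (real d + e) / 4 ^ n) ` E x y)" using a(2) by blast
    then show "z \<in> E x y" using Suc by blast
  qed
qed

lemma E_levelE:
  assumes "z \<in> E x y"
  obtains d e where "d \<in> sums4 x y n" "e \<in> E x y" "z = (real d + e) / 4 ^ n"
  using assms E_level[of x y n] by blast

lemma E_levelI: "d \<in> sums4 x y n \<Longrightarrow> e \<in> E x y \<Longrightarrow> (real d + e) / 4 ^ n \<in> E x y"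
  using E_level[of x y n] by blast

section \<open>Intervals, interior points and holes\<close>

text \<open>
  For \<open>y = 2 * x\<close> the digits are \<open>0\<close>, \<open>x\<close>, \<open>2 * x\<close> and \<open>3 * x\<close>, and the expansions are those of ordinary base \<open>4\<close>.
\<close>
lemma E_double: "E x (2 * x) = {0..real x}"
proof
  show "E x (2 * x) \<subseteq> {0..real x}" using E_bounds[of _ x "2 * x"] by auto
  show "{0..real x} \<subseteq> E x (2 * x)"
  proof (rule E_maximal)
    fix z assume z: "z \<in> {0..real x}"
    then show "\<bar>z\<bar> \<le> real x" by auto
    have digit: "x * j \<in> digits x (2 * x)" if "j \<in> {0, 1, 2, 3}" for j
      using that by (auto simp: digits_def)
    have "\<exists>j\<in>{0, 1, 2, 3 :: nat}. real (x * j) \<le> 4 * z \<and> 4 * z \<le> real (x * j) + real x"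
      using z by simp linarith
    then obtain j where "j \<in> {0, 1, 2, 3 :: nat}" "real (x * j) \<le> 4 * z" "4 * z \<le> real (x * j) + real x" by blast
    then show "\<exists>d\<in>digits x (2 * x). 4 * z - real d \<in> {0..real x}"
      using digit by (intro bexI[of _ "x * j"]) auto
  qed
qed

text \<open>
  Each factor \<open>4\<close> in \<open>y\<close> doubles the number of intervals: the set is replaced by its union with its translate by \<open>y\<close>,
  and \<open>y\<close> exceeds the diameter \<open>(x + y) / 3\<close>.
\<close>
lemma E_disjoint_intervals:
  assumes "x \<ge> 1"
  shows "\<exists>F. card F = 2 ^ t \<and> (\<forall>I\<in>F. closed_interval I) \<and> pairwise disjnt F \<and> E x (2 * 4 ^ t * x) = \<Union>F"
proof (induction t)
  case 0
  have "closed_interval {0..real x}" unfolding closed_interval_def using assms by force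
  then show ?case using E_double[of x] by (intro exI[of _ "{{0..real x}}"]) auto
next
  case (Suc t)
  define y where "y = 2 * 4 ^ t * x"
  obtain F where F: "card F = 2 ^ t" "\<forall>I\<in>F. closed_interval I" "pairwise disjnt F" "E x y = \<Union>F"
    using Suc unfolding y_def by blast
  define \<tau> where "\<tau> = (\<lambda>I. (\<lambda>e. e + real y) ` I)"
  have "finite F" using F(1) by (metis card.infinite power_not_zero zero_neq_numeral)
  have inj: "inj_on \<tau> F" unfolding \<tau>_def by (intro inj_onI) (simp add: inj_image_eq_iff)
  have "real x < 2 * real y" using assms by (simp add: y_def) (smt (verit) one_le_power mult_le_cancel_right1 of_nat_1 of_nat_mono)
  then have sep: "I \<inter> \<tau> J = {}" if "I \<in> F" "J \<in> F" for I J
  proof -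
    have "u \<noteq> v + real y" if "u \<in> E x y" "v \<in> E x y" for u v
      using E_bounds[OF that(1)] E_bounds[OF that(2)] \<open>real x < 2 * real y\<close> by auto
    then show ?thesis using that F(4) unfolding \<tau>_def by blast
  qed
  have nonempty: "I \<noteq> {}" if "I \<in> F" for I using F(2) that by (auto simp: closed_interval_def)
  have "F \<inter> \<tau> ` F = {}" using sep nonempty by blast
  then have "card (F \<union> \<tau> ` F) = 2 ^ Suc t"
    using \<open>finite F\<close> F(1) by (simp add: card_Un_disjoint card_image[OF inj])
  moreover have "closed_interval (\<tau> I)" if I: "I \<in> F" for I
  proof -
    obtain a b where "a < b" "I = {a..b}" using bspec[OF F(2) I] unfolding closed_interval_def by blast
    then have "\<tau> I = {a + real y..b + real y}" "a + real y < b + real y" by (simp_all add: \<tau>_def)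
    then show ?thesis unfolding closed_interval_def by blast
  qed
  moreover have "pairwise disjnt (F \<union> \<tau> ` F)"
  proof (rule pairwiseI)
    have unshifted: "disjnt I J" if "I \<in> F" "J \<in> F" "I \<noteq> J" for I J
      using F(3) that unfolding pairwise_def by blast
    have shifted: "disjnt (\<tau> I) (\<tau> J)" if "I \<in> F" "J \<in> F" "\<tau> I \<noteq> \<tau> J" for I J
    proof -
      have "disjnt I J" using unshifted that by blast
      then show ?thesis by (auto simp: disjnt_def \<tau>_def)
    qed
    have crossed: "disjnt I (\<tau> J)" "disjnt (\<tau> J) I" if "I \<in> F" "J \<in> F" for I J
      using sep[OF that] by (auto simp: disjnt_def)
    fix I J assume "I \<in> F \<union> \<tau> ` F" "J \<in> F \<union> \<tau> ` F" "I \<noteq> J"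
    then show "disjnt I J" using unshifted shifted crossed by (elim UnE imageE) simp_all
  qed
  moreover have "E x (2 * 4 ^ Suc t * x) = \<Union>(F \<union> \<tau> ` F)"
  proof -
    have "E x (2 * 4 ^ Suc t * x) = E x y \<union> (\<lambda>e. e + real y) ` E x y"
      using E_shift[of x y] by (simp add: y_def algebra_simps)
    then show ?thesis unfolding F(4) \<tau>_def by auto
  qed
  ultimately show ?case using F(2) by (intro exI[of _ "F \<union> \<tau> ` F"]) blast
qed

text \<open>
  For odd \<open>x\<close> and \<open>y\<close> the digits \<open>0\<close>, \<open>x\<close>, \<open>2 * y\<close>, \<open>x + 2 * y\<close> represent every residue modulo \<open>4\<close>, and digits can be split off one
  at a time.
\<close>
lemma sums4_residue:
  assumes "odd x" "odd y"
  shows "\<exists>d\<in>sums4 x (2 * y) n. \<exists>k :: int. m = int d + 4 ^ n * k"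
proof (induction n arbitrary: m)
  case (Suc n)
  have "\<exists>d\<in>digits x (2 * y). \<exists>k :: int. m = int d + 4 * k"
  proof -
    have "m mod 4 = int 0 mod 4 \<or> m mod 4 = int x mod 4 \<or> m mod 4 = int (2 * y) mod 4 \<or> m mod 4 = int (x + 2 * y) mod 4"
    proof -
      obtain a b where "x = 2 * a + 1" "y = 2 * b + 1" using assms by (metis oddE)
      then have "int (2 * y) mod 4 = 2"
        "int x mod 4 = 1 \<and> int (x + 2 * y) mod 4 = 3 \<or> int x mod 4 = 3 \<and> int (x + 2 * y) mod 4 = 1"
        by simp_all presburger+
      moreover have "m mod 4 = 0 \<or> m mod 4 = 1 \<or> m mod 4 = 2 \<or> m mod 4 = 3" by presburger
      ultimately show ?thesis by auto
    qed
    then have "\<exists>d\<in>digits x (2 * y). m mod 4 = int d mod 4" by (auto simp: digits_def)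
    then show ?thesis by (metis mod_eqE)
  qed
  then obtain d k where d: "d \<in> digits x (2 * y)" "m = int d + 4 * k" by blast
  obtain d' k' where d': "d' \<in> sums4 x (2 * y) n" "k = int d' + 4 ^ n * k'" using Suc by blast
  have "d + 4 * d' \<in> sums4 x (2 * y) (Suc n)" using d(1) d'(1) by force
  moreover have "m = int (d + 4 * d') + 4 ^ Suc n * k'" unfolding d(2) d'(2) by (simp add: algebra_simps)
  ultimately show ?case by blast
qed auto

text \<open>
  Applied to \<open>\<lfloor>z * 4 ^ n\<rfloor>\<close>, the residue expansion puts \<open>z\<close> within \<open>4 ^ (- n)\<close> of an integer translate of the
  set, and for \<open>z\<close> in the unit interval only finitely many translates occur. They cover the unit interval, and a finite
  union of closed sets without interior has no interior.
\<close>
lemma interior_E_residues: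
  assumes "odd x" "odd y"
  shows "interior (E x (2 * y)) \<noteq> {}"
proof
  assume empty: "interior (E x (2 * y)) = {}"
  define c where "c = x + 2 * y"
  define T where "T k = (\<lambda>e. real_of_int k + e) ` E x (2 * y)" for k
  define U where "U = (\<Union>k\<in>{- int c - 1..1}. T k)"
  have closed: "closed (T k)" for k
    unfolding T_def by (rule closed_translation[OF compact_imp_closed[OF compact_E]])
  have "interior (\<Union>k\<in>K. T k) = {}" if "finite K" for K
    using that
  proof (induction K rule: finite_induct)
    case (insert k K)
    have "interior (T k) = {}" unfolding T_def interior_translation empty by simp
    then show ?case using interior_closed_Un_empty_interior[of "\<Union>k\<in>K. T k" "T k"] closed insert
      by (simp add: Un_commute closed_UN)
  qed auto
  then have "interior U = {}" unfolding U_def by simp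
  have "closed U" unfolding U_def using closed by (intro closed_UN) auto
  have "{0..1} \<subseteq> U"
  proof
    fix z :: real assume z: "z \<in> {0..1}"
    have "\<exists>w\<in>U. dist w z < e" if e: "0 < e" for e
    proof -
      obtain n where n: "(1 / 4 :: real) ^ n < e" using real_arch_pow_inv[OF e, of "1/4"] by auto
      obtain d k where d: "d \<in> sums4 x (2 * y) n" "\<lfloor>z * 4 ^ n\<rfloor> = int d + 4 ^ n * k"
        using sums4_residue[OF assms] by blast
      define u where "u = (real d + 0) / 4 ^ n"
      define w where "w = real_of_int k + u"
      have floor: "real_of_int \<lfloor>z * 4 ^ n\<rfloor> = 4 ^ n * w"
        unfolding d(2) w_def u_def by (simp add: field_simps)
      have "4 ^ n * w \<le> 4 ^ n * z" "4 ^ n * z < 4 ^ n * w + 1"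
        using floor by (metis of_int_floor_le mult.commute, metis floor_correct mult.commute of_int_add of_int_1)
      then have "w \<le> z" "z < w + (1 / 4) ^ n"
        by (simp, simp add: field_simps power_one_over)
      have E: "u \<in> E x (2 * y)" unfolding u_def by (rule E_levelI[OF d(1) zero_in_E])
      have "u \<le> (real x + real (2 * y)) / 3" "0 \<le> u" using E_bounds[OF E] by auto
      moreover have "(real x + real (2 * y)) / 3 \<le> real c" by (simp add: c_def)
      ultimately have "w - real_of_int k \<le> real c" "0 \<le> w - real_of_int k" by (simp_all add: w_def)
      moreover have "(1 / 4 :: real) ^ n \<le> 1" by (rule power_le_one) auto
      ultimately have "real_of_int k < 2" "- real c - 2 < real_of_int k" using z \<open>w \<le> z\<close> \<open>z < w + (1 / 4) ^ n\<close> by auto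
      then have "k \<in> {- int c - 1..1}" by auto
      then have "w \<in> U" unfolding U_def T_def w_def using E by blast
      then show ?thesis using n \<open>w \<le> z\<close> \<open>z < w + (1 / 4) ^ n\<close> by (intro bexI[of _ w]) (auto simp: dist_real_def)
    qed
    then have "z \<in> closure U" unfolding closure_approachable by blast
    then show "z \<in> U" using \<open>closed U\<close> by simp
  qed
  then have "interior {0..1 :: real} \<subseteq> interior U" by (rule interior_mono)
  moreover have "1/2 \<in> interior {0..1 :: real}" by simp
  ultimately show False using \<open>interior U = {}\<close> by blast
qed

lemma interior_E_shift: "interior (E x y) \<noteq> {} \<Longrightarrow> interior (E (4 ^ p * x) (4 ^ q * y)) \<noteq> {}"
proof -
  have step: "interior (E x y) \<noteq> {} \<Longrightarrow> interior (E x (4 ^ q * y)) \<noteq> {}" for x y q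
  proof (induction q)
    case (Suc q)
    have "interior (E x (4 ^ q * y)) \<subseteq> interior (E x (4 * (4 ^ q * y)))"
      unfolding E_shift by (rule interior_mono) simp
    then show ?case using Suc by (auto simp: mult.assoc)
  qed simp
  show "interior (E x y) \<noteq> {} \<Longrightarrow> interior (E (4 ^ p * x) (4 ^ q * y)) \<noteq> {}"
    using step[of x y q] step[of "4 ^ q * y" x p] by (simp add: E_commute)
qed

text \<open>
  If none of the first \<open>n\<close> powers of \<open>1 / 4\<close> is used, the rest adds up to at most a third of the last one.
\<close>
lemma base_set_jump: "u \<in> E 1 0 \<Longrightarrow> u \<le> 1 / 4 ^ n / 3 \<or> 1 / 4 ^ n \<le> u"
proof (induction n arbitrary: u)
  case 0
  then show ?case using E_bounds[OF 0] by simp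
next
  case (Suc n)
  obtain d u' where u: "d \<in> digits 1 0" "u' \<in> E 1 0" "u = (real d + u') / 4" using Suc.prems by (rule E_uncons)
  show ?case
  proof (cases "d = 0")
    case True
    then show ?thesis using Suc.IH[OF u(2)] u(3) by (auto simp: field_simps)
  next
    case False
    then have "1 / 4 \<le> u" using u E_bounds[OF u(2)] by (auto simp: digits_def)
    moreover have "1 / 4 ^ Suc n \<le> (1 / 4 :: real)" by (simp add: field_simps)
    ultimately show ?thesis by linarith
  qed
qed

text \<open>
  Either a term at least as large as \<open>X\<close> or \<open>Y\<close> is used, or all terms used add up to at most \<open>(X + Y) / 3\<close>.
\<close>
lemma E_hole:
  fixes X Y :: real
  assumes "X = real x / 4 ^ m" "Y = real y / 4 ^ n" "(X + Y) / 3 < z" "z < X" "z < Y"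
  shows "z \<notin> E x y"
proof
  assume "z \<in> E x y"
  then obtain u v where uv: "u \<in> E 1 0" "v \<in> E 1 0" "z = real x * u + real y * v" unfolding E_iff[of z] by blast
  have pos: "0 \<le> real x * u" "0 \<le> real y * v" using E_bounds(1)[OF uv(1)] E_bounds(1)[OF uv(2)] by auto
  have "real x * u \<le> real x * (1 / 4 ^ m / 3) \<or> real x * (1 / 4 ^ m) \<le> real x * u"
    using base_set_jump[OF uv(1), of m] by (metis mult_left_mono of_nat_0_le_iff)
  moreover have "real y * v \<le> real y * (1 / 4 ^ n / 3) \<or> real y * (1 / 4 ^ n) \<le> real y * v"
    using base_set_jump[OF uv(2), of n] by (metis mult_left_mono of_nat_0_le_iff)
  ultimately have "real x * u \<le> X / 3 \<or> X \<le> real x * u" "real y * v \<le> Y / 3 \<or> Y \<le> real y * v"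
    using assms(1,2) by auto
  then show False using uv(3) pos assms(3-5) by argo
qed

text \<open>
  Some power \<open>4 powi k\<close> brings the ratio \<open>x * 4 powi k / y\<close> into the interval \<open>{1/2<..2}\<close>. The excluded relation is
  exactly that the ratio lands on the endpoint \<open>2\<close>.
\<close>
lemma comparable_scales:
  assumes "x \<ge> 1" "y \<ge> 1" and no_double: "\<nexists>t :: int. real y = 2 * 4 powi t * real x"
  obtains m n :: nat where "real x / 4 ^ m < 2 * (real y / 4 ^ n)" "real y / 4 ^ n < 2 * (real x / 4 ^ m)"
proof -
  define k where "k = \<lfloor>log 4 (2 * real y / real x)\<rfloor>"
  have pos: "real x > 0" "real y > 0" using assms by auto
  have "real_of_int k \<le> log 4 (2 * real y / real x)" "log 4 (2 * real y / real x) < real_of_int k + 1"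
    unfolding k_def by linarith+
  then have "4 powr real_of_int k \<le> 2 * real y / real x" "2 * real y / real x < 4 powr (real_of_int k + 1)"
    using pos le_log_iff[of 4 "2 * real y / real x"] log_less_iff[of 4 "2 * real y / real x"] by simp_all
  then have k: "4 powi k * real x \<le> 2 * real y" "2 * real y < 4 * (4 powi k * real x)"
    using pos by (simp_all add: powr_add powr_real_of_int' field_simps)
  have "4 powi k * real x \<noteq> 2 * real y"
  proof
    assume "4 powi k * real x = 2 * real y"
    then have "real y = 2 * 4 powi (k - 1) * real x" by (simp add: power_int_diff)
    then show False using no_double by blast
  qed
  then have k1: "4 powi k * real x < 2 * real y" using k(1) by linarith
  show thesis
  proof (cases "k \<ge> 0")
    case True
    then have "(4 :: real) powi k = 4 ^ nat k" by (simp add: power_int_def)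
    then show ?thesis using k1 k(2) by (intro that[of 0 "nat k"]) (auto simp: field_simps)
  next
    case False
    then have "(4 :: real) powi k = 1 / 4 ^ nat (- k)" by (simp add: power_int_def power_one_over inverse_eq_divide)
    note k1[unfolded this] k(2)[unfolded this]
    then show ?thesis by (intro that[of "nat (- k)" 0]) (auto simp: field_simps)
  qed
qed

lemma E_holes_at_zero:
  assumes "x \<ge> 1" "y \<ge> 1" "\<nexists>t :: int. real y = 2 * 4 powi t * real x" "0 < e"
  obtains z where "0 < z" "z < e" "z \<notin> E x y"
proof -
  obtain m n :: nat where mn: "real x / 4 ^ m < 2 * (real y / 4 ^ n)" "real y / 4 ^ n < 2 * (real x / 4 ^ m)"
    using comparable_scales[OF assms(1-3)] by blast
  have "0 < e / real x" using assms by simp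
  then obtain j where j: "(1 / 4 :: real) ^ j < e / real x" using real_arch_pow_inv[of "e / real x" "1/4"] by auto
  define X where "X = real x / 4 ^ (m + j)"
  define Y where "Y = real y / 4 ^ (n + j)"
  have XY: "X = real x / 4 ^ m / 4 ^ j" "Y = real y / 4 ^ n / 4 ^ j" by (simp_all add: X_def Y_def power_add)
  have "X < 2 * Y" "Y < 2 * X" unfolding XY using mn by (simp_all add: divide_strict_right_mono field_simps)
  then have "(X + Y) / 3 < min X Y" by auto
  then obtain z where z: "(X + Y) / 3 < z" "z < X" "z < Y" by (metis Orderings.dense min_less_iff_conj)
  have "0 < X" "0 < Y" using assms by (auto simp: X_def Y_def)
  then have "0 < (X + Y) / 3" by simp
  then have "0 < z" using z(1) by (rule less_trans)
  have "X \<le> real x * (1 / 4) ^ j" unfolding X_def using assms(1) by (simp add: field_simps power_add)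
  also have "\<dots> < e" using j assms(1) by (simp add: field_simps)
  finally have "z < e" using z(2) by simp
  then show thesis using that[of z] \<open>0 < z\<close> E_hole[OF X_def Y_def z] by blast
qed

text \<open>
  Every point lies in arbitrarily small copies of the whole set, and each copy contains interior points.
\<close>
lemma E_in_closure_interior:
  assumes "interior (E x y) \<noteq> {}"
  shows "E x y \<subseteq> closure (interior (E x y))"
proof
  obtain w where w: "w \<in> interior (E x y)" using assms by blast
  then have wE: "w \<in> E x y" using interior_subset by blast
  fix p assume p: "p \<in> E x y"
  define c where "c = (real x + real y) / 3 + 1"
  have "c > 0" by (simp add: c_def add_nonneg_pos)
  have "\<exists>q\<in>interior (E x y). dist q p < e" if e: "0 < e" for e
  proof -
    obtain n where n: "(1 / 4 :: real) ^ n < e / c"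
      using real_arch_pow_inv[of "e / c" "1/4"] e \<open>c > 0\<close> by auto
    obtain d t where d: "d \<in> sums4 x y n" "t \<in> E x y" "p = (real d + t) / 4 ^ n" using p by (rule E_levelE)
    let ?f = "\<lambda>e. real d / 4 ^ n + (1 / 4 ^ n) * e"
    have "open (?f ` interior (E x y))"
    proof -
      have "open ((\<lambda>e. real d / 4 ^ n + e) ` (\<lambda>e. (1 / 4 ^ n) *\<^sub>R e) ` interior (E x y))"
        by (intro open_translation open_scaling) auto
      then show ?thesis by (simp add: image_image)
    qed
    moreover have "?f ` interior (E x y) \<subseteq> E x y"
    proof
      fix q assume "q \<in> ?f ` interior (E x y)"
      then obtain e where "e \<in> E x y" "q = (real d + e) / 4 ^ n"
        using interior_subset[of "E x y"] by (auto simp: add_divide_distrib)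
      then show "q \<in> E x y" using E_levelI[OF d(1)] by simp
    qed
    ultimately have "?f w \<in> interior (E x y)" using w by (meson image_eqI interior_maximal subsetD)
    moreover have "dist (?f w) p < e"
    proof -
      have "w \<le> c - 1" "t \<le> c - 1" using E_bounds(2)[OF wE] E_bounds(2)[OF d(2)] by (simp_all add: c_def)
      then have "\<bar>w - t\<bar> < c" using E_bounds(1)[OF wE] E_bounds(1)[OF d(2)] by linarith
      have "?f w - p = (w - t) * (1 / 4) ^ n" unfolding d(3) by (simp add: field_simps power_one_over)
      then have "\<bar>?f w - p\<bar> = \<bar>w - t\<bar> * (1 / 4) ^ n" by (simp add: abs_mult)
      also have "\<dots> \<le> c * (1 / 4) ^ n" using \<open>\<bar>w - t\<bar> < c\<close> by (intro mult_right_mono) auto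
      also have "\<dots> < e" using n \<open>c > 0\<close> by (simp add: field_simps)
      finally show ?thesis by (simp add: dist_real_def)
    qed
    ultimately show ?thesis by blast
  qed
  then show "p \<in> closure (interior (E x y))" unfolding closure_approachable by blast
qed

section \<open>The set as a Cantorval\<close>

text \<open>
  Take copies of level \<open>n\<close> so small that they are shorter than the hole to the left of \<open>p\<close>. The left end of any copy containing
  \<open>p\<close> is a point of the set that is not inside the hole, so it is \<open>p\<close> itself. Hence \<open>p\<close> determines the
  copy, all other copies keep a positive distance from \<open>p\<close>, and the holes of that copy near its left end are holes of the
  whole set.
\<close>
lemma E_holes_right_of_exposed:
  assumes holes: "\<And>e. 0 < e \<Longrightarrow> \<exists>z. 0 < z \<and> z < e \<and> z \<notin> E x y"
    and "exposed_left (E x y) p" "0 < e"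
  shows "\<exists>z. p < z \<and> z < p + e \<and> z \<notin> E x y"
proof -
  obtain \<delta> where p: "p \<in> E x y" and \<delta>: "\<delta> > 0" "{p-\<delta><..<p} \<inter> E x y = {}"
    using assms(2) by (auto simp: exposed_left_def)
  define c where "c = (real x + real y) / 3 + 1"
  have "c > 0" by (simp add: c_def add_nonneg_pos)
  obtain n where n: "(1 / 4 :: real) ^ n < \<delta> / c"
    using real_arch_pow_inv[of "\<delta> / c" "1/4"] \<delta>(1) \<open>c > 0\<close> by auto
  have exact: "t = 0" if "d \<in> sums4 x y n" "t \<in> E x y" "p = (real d + t) / 4 ^ n" for d t
  proof -
    have "(real d + 0) / 4 ^ n \<in> E x y" by (rule E_levelI[OF that(1) zero_in_E])
    then have "\<not> (p - \<delta> < real d / 4 ^ n \<and> real d / 4 ^ n < p)" using \<delta>(2) by auto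
    moreover have "p - real d / 4 ^ n = t * (1 / 4) ^ n"
      unfolding that(3) by (simp add: field_simps power_one_over)
    moreover have "t \<le> c" using E_bounds(2)[OF that(2)] unfolding c_def by linarith
    then have "t * (1 / 4) ^ n \<le> c * (1 / 4) ^ n" by (intro mult_right_mono) auto
    moreover have "c * (1 / 4) ^ n < \<delta>" using n \<open>c > 0\<close> by (simp add: field_simps)
    ultimately have "t * (1 / 4) ^ n \<le> 0" by linarith
    moreover have "0 < (1 / 4 :: real) ^ n" by simp
    ultimately have "t \<le> 0" by (meson mult_pos_pos not_le)
    then show ?thesis using E_bounds(1)[OF that(2)] by simp
  qed
  obtain d where d: "d \<in> sums4 x y n" "p = real d / 4 ^ n"
    using E_levelE[OF p, of n] exact by (metis add.right_neutral)
  \<comment> \<open>The union of the copies that do not contain p.\<close>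
  define R where "R = (\<Union>d'\<in>sums4 x y n - {d}. (\<lambda>e. (real d' + e) / 4 ^ n) ` E x y)"
  have "closed R" unfolding R_def
    by (intro closed_UN finite_Diff finite_sums4 ballI compact_imp_closed compact_continuous_image
        compact_E continuous_intros) auto
  moreover have "p \<notin> R"
  proof
    assume "p \<in> R"
    then obtain d' t where "d' \<in> sums4 x y n" "d' \<noteq> d" "t \<in> E x y" "p = (real d' + t) / 4 ^ n"
      unfolding R_def by blast
    with exact[OF this(1,3,4)] d(2) show False by auto
  qed
  ultimately obtain \<eta> where \<eta>: "\<eta> > 0" "ball p \<eta> \<inter> R = {}"
    by (metis Compl_disjoint2 ComplI disjoint_eq_subset_Compl openE open_Compl inf_commute)
  obtain w where w: "0 < w" "w < min e \<eta> * 4 ^ n" "w \<notin> E x y"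
    using holes[of "min e \<eta> * 4 ^ n"] assms(3) \<eta>(1) by auto
  define z where "z = (real d + w) / 4 ^ n"
  have z: "z - p = w / 4 ^ n" unfolding z_def d(2) by (simp add: add_divide_distrib)
  have "0 < w / 4 ^ n" "w / 4 ^ n < min e \<eta>" using w(1,2) by (simp_all only: divide_less_eq zero_less_divide_iff) simp_all
  then have near: "p < z" "z < p + e" "z < p + \<eta>" using z by auto
  have "z \<notin> E x y"
  proof
    assume "z \<in> E x y"
    then obtain d' t where t: "d' \<in> sums4 x y n" "t \<in> E x y" "z = (real d' + t) / 4 ^ n" by (rule E_levelE)
    have "z \<in> ball p \<eta>" using near by (auto simp: dist_real_def)
    then have "z \<notin> R" using \<eta>(2) by blast
    then have "d' = d" using t unfolding R_def by blast
    then have "w = t" using t(3) unfolding z_def by simp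
    then show False using w(3) t(2) by simp
  qed
  then show ?thesis using near by blast
qed

lemma exposed_E_reflect:
  assumes "exposed_right (E x y) p"
  shows "exposed_left (E x y) ((real x + real y) / 3 - p)"
proof -
  let ?c = "(real x + real y) / 3"
  obtain \<delta> where \<delta>: "p \<in> E x y" "\<delta> > 0" "{p<..<p+\<delta>} \<inter> E x y = {}"
    using assms by (auto simp: exposed_right_def)
  have "{?c - p - \<delta><..<?c - p} \<inter> E x y = {}"
  proof (rule equals0I)
    fix z assume "z \<in> {?c - p - \<delta><..<?c - p} \<inter> E x y"
    then have "?c - z \<in> {p<..<p+\<delta>} \<inter> E x y" using E_reflect[of z x y] by auto
    then show False using \<delta>(3) by blast
  qed
  then show ?thesis using \<delta>(2) E_reflect[OF \<delta>(1)] by (auto simp: exposed_left_def)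
qed

lemma cantorval_E:
  assumes "interior (E x y) \<noteq> {}"
    and holes: "\<And>e. 0 < e \<Longrightarrow> \<exists>z. 0 < z \<and> z < e \<and> z \<notin> E x y"
  shows "cantorval (E x y)"
proof (rule cantorval_criterion, unfold cantorval_like_def, intro conjI allI impI)
  show "E x y \<noteq> {}" using zero_in_E by blast
  fix p e :: real
  assume "0 < e"
  show "\<exists>z. p < z \<and> z < p + e \<and> z \<notin> E x y" if "exposed_left (E x y) p"
    by (rule E_holes_right_of_exposed[OF holes that \<open>0 < e\<close>])
  show "\<exists>z. p - e < z \<and> z < p \<and> z \<notin> E x y" if p: "exposed_right (E x y) p"
  proof -
    let ?c = "(real x + real y) / 3"
    obtain z where "?c - p < z" "z < ?c - p + e" "z \<notin> E x y"
      using E_holes_right_of_exposed[OF holes exposed_E_reflect[OF p] \<open>0 < e\<close>] by blast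
    then show ?thesis using E_reflect[of "?c - z" x y] by (intro exI[of _ "?c - z"]) auto
  qed
qed (use compact_E E_in_closure_interior[OF assms(1)] in auto)

section \<open>Coinciding digit sums\<close>

lemma card_digits_le: "card (digits x y) \<le> 4"
  unfolding digits_def by (simp add: card_insert_if)

lemma card_sums4_le: "card (sums4 x y n) \<le> 4 ^ n"
proof (induction n)
  case (Suc n)
  have "card (sums4 x y (Suc n)) \<le> card (digits x y \<times> sums4 x y n)"
    unfolding sums4.simps by (intro card_image_le) simp
  also have "\<dots> \<le> 4 * 4 ^ n"
    unfolding card_cartesian_product using card_digits_le Suc by (rule mult_le_mono)
  finally show ?case by simp
qed simp

lemma sums4_mult: "sums4 (c * x) (c * y) n = (*) c ` sums4 x y n"
proof (induction n)
  case (Suc n)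
  have "digits (c * x) (c * y) = (*) c ` digits x y" by (auto simp: digits_def distrib_left)
  then have "digits (c * x) (c * y) \<times> sums4 (c * x) (c * y) n = map_prod ((*) c) ((*) c) ` (digits x y \<times> sums4 x y n)"
    using Suc by (simp add: map_prod_surj_on)
  then show ?case
    by (simp add: image_image case_prod_unfold distrib_left mult.left_commute)
qed simp

text \<open>
  The power is \<open>-1\<close> only if \<open>2 * 4 ^ p * m\<close> is an odd multiple of a power of \<open>4\<close>, whereas \<open>2\<close> divides
  it an odd number of times.
\<close>
lemma one_plus_cis_nonzero:
  assumes "odd m"
  shows "1 + cis (2 * pi / 4 ^ Suc k) ^ (4 ^ p * m) \<noteq> 0"
proof
  assume "1 + cis (2 * pi / 4 ^ Suc k) ^ (4 ^ p * m) = 0"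
  then have "cis (real (4 ^ p * m) * (2 * pi / 4 ^ Suc k)) = cis pi"
    unfolding Complex.DeMoivre cis_pi add_eq_0_iff .
  then have "sin (real (4 ^ p * m) * (2 * pi / 4 ^ Suc k)) = sin pi \<and>
      cos (real (4 ^ p * m) * (2 * pi / 4 ^ Suc k)) = cos pi"
    by (metis cis.sel)
  then obtain j :: int where "real (4 ^ p * m) * (2 * pi / 4 ^ Suc k) = pi + 2 * pi * of_int j"
    unfolding sin_cos_eq_iff by blast
  then have "pi * (2 * real (4 ^ p * m)) = pi * (4 ^ Suc k * (1 + 2 * of_int j))"
    by (simp add: field_simps)
  then have "2 * real (4 ^ p * m) = 4 ^ Suc k * (1 + 2 * of_int j)" by simp
  then have "real_of_int (2 * (4 ^ p * int m)) = real_of_int (4 ^ Suc k * (1 + 2 * j))" by simp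
  then have eq: "2 * (4 ^ p * int m) = 4 ^ Suc k * (1 + 2 * j)" unfolding of_int_eq_iff .
  show False
  proof (cases "p \<le> k")
    case True
    then have "Suc k = p + Suc (k - p)" by simp
    then have "(4 :: int) ^ Suc k = 4 ^ p * 4 ^ Suc (k - p)" by (metis power_add)
    then have "int m = 2 * (4 ^ (k - p) * (1 + 2 * j))" using eq by simp
    then show False using assms by presburger
  next
    case False
    then have "p = Suc k + (p - Suc k)" by simp
    then have "(4 :: int) ^ p = 4 ^ Suc k * 4 ^ (p - Suc k)" by (metis power_add)
    then have "2 * (4 ^ (p - Suc k) * int m) = 1 + 2 * j" using eq by simp
    then show False by presburger
  qed
qed

text \<open>
  The hypothesis \<open>full\<close> says that expansions of equal length with distinct digits have distinct values. It
  is refuted for numbers with an even exponent of \<open>2\<close> in lemma \<open>full_contradiction\<close>.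
\<close>
context
  fixes x y :: nat
  assumes full: "\<And>n. card (sums4 x y n) = 4 ^ n"
begin

lemma sums4_inj:
  "inj_on (\<lambda>(d, e). d + 4 ^ m * e) (sums4 x y m \<times> sums4 x y n)"
proof (rule eq_card_imp_inj_on)
  show "card ((\<lambda>(d, e). d + 4 ^ m * e) ` (sums4 x y m \<times> sums4 x y n)) = card (sums4 x y m \<times> sums4 x y n)"
    unfolding sums4_add[symmetric] by (simp add: full card_cartesian_product power_add)
qed simp

lemma sum_sums4_add:
  fixes g :: "nat \<Rightarrow> complex"
  shows "sum g (sums4 x y (m + n)) = (\<Sum>d\<in>sums4 x y m. \<Sum>e\<in>sums4 x y n. g (d + 4 ^ m * e))"
  unfolding sums4_add sum.reindex[OF sums4_inj] sum.cartesian_product by (simp add: case_prod_unfold)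

lemma digits_distinct: "x \<noteq> 0" "y \<noteq> 0" "x \<noteq> y"
proof -
  have "sums4 x y 1 = digits x y" by (simp add: image_iff) force
  then have "card {0, x, y, x + y} = 4" using full[of 1] by (simp add: digits_def)
  then show "x \<noteq> 0" "y \<noteq> 0" "x \<noteq> y" by (auto simp: card_insert_if split: if_splits)
qed

text \<open>
  Splitting off the digit of weight \<open>1\<close> gives the factor \<open>(1 + \<omega>^x) * (1 + \<omega>^y)\<close>; the remaining sum is the same
  one at \<open>\<omega>^4\<close>.
\<close>
lemma generating_sum_nonzero:
  assumes "x = 4 ^ p * x'" "odd x'" "y = 4 ^ q * y'" "odd y'"
  shows "(\<Sum>e\<in>sums4 x y k. cis (2 * pi / 4 ^ k) ^ e) \<noteq> 0"
proof (induction k)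
  case (Suc k)
  define \<omega> where "\<omega> = cis (2 * pi / 4 ^ Suc k)"
  have "real 4 * (2 * pi / 4 ^ Suc k) = 2 * pi / 4 ^ k" by simp
  then have "\<omega> ^ 4 = cis (2 * pi / 4 ^ k)" unfolding \<omega>_def Complex.DeMoivre by (rule arg_cong)
  have digits: "sums4 x y 1 = digits x y" by (simp add: image_iff) force
  have "(\<Sum>e\<in>sums4 x y (Suc k). \<omega> ^ e) = (\<Sum>d\<in>digits x y. \<omega> ^ d) * (\<Sum>e\<in>sums4 x y k. (\<omega> ^ 4) ^ e)"
    using sum_sums4_add[of "\<lambda>e. \<omega> ^ e" 1 k] unfolding digits
    by (simp add: power_add power_mult sum_product)
  also have "(\<Sum>d\<in>digits x y. \<omega> ^ d) = (1 + \<omega> ^ x) * (1 + \<omega> ^ y)"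
    using digits_distinct by (simp add: digits_def algebra_simps power_add)
  finally show ?case
    using Suc one_plus_cis_nonzero[OF assms(2), of k p] one_plus_cis_nonzero[OF assms(4), of k q]
    unfolding \<omega>_def[symmetric] \<open>\<omega> ^ 4 = _\<close> assms(1)[symmetric] assms(3)[symmetric] by simp
qed simp

definition residue_class :: "nat \<Rightarrow> nat \<Rightarrow> nat set" where
  "residue_class n j = {d \<in> sums4 x y n. d mod 4 ^ n = j}"

lemma card_residue_class_le: "card (residue_class n j) \<le> x + y"
proof -
  have "inj_on (\<lambda>d. d div 4 ^ n) (residue_class n j)"
    by (rule inj_onI) (metis (mono_tags, lifting) residue_class_def div_mult_mod_eq mem_Collect_eq)
  moreover have "(\<lambda>d. d div 4 ^ n) ` residue_class n j \<subseteq> {..<x + y}"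
  proof (rule image_subsetI)
    fix d assume "d \<in> residue_class n j"
    then have "3 * d + (x + y) \<le> (x + y) * 4 ^ n" by (auto simp: residue_class_def intro: sums4_bound)
    then have "d < (x + y) * 4 ^ n" using digits_distinct by linarith
    then show "d div 4 ^ n \<in> {..<x + y}" by (simp add: less_mult_imp_div_less)
  qed
  ultimately have "card (residue_class n j) \<le> card {..<x + y}" by (intro card_inj_on_le) auto
  then show ?thesis by simp
qed

text \<open>
  The sizes of the classes are bounded, since digit sums of length \<open>n\<close> are less than \<open>(x + y) * 4 ^ n\<close>.
\<close>
lemma maximal_residue_class:
  obtains n j where "card (residue_class n j) \<ge> 1"
    "\<And>n' j'. card (residue_class n' j') \<le> card (residue_class n j)"
proof -
  have "finite {card (residue_class n j) | n j. True}"
    by (rule finite_subset[of _ "{..x + y}"]) (use card_residue_class_le in auto)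
  moreover have 1: "card (residue_class 0 0) = 1" by (simp add: residue_class_def)
  ultimately have M: "Max {card (residue_class n j) | n j. True} \<in> {card (residue_class n j) | n j. True}"
    by (intro Max_in) auto
  then obtain n j where nj: "card (residue_class n j) = Max {card (residue_class n j) | n j. True}" by force
  have "card (residue_class n' j') \<le> card (residue_class n j)" for n' j'
    unfolding nj by (rule Max_ge) (use \<open>finite _\<close> in auto)
  then show thesis using 1 by (metis that)
qed

text \<open>
  Digits of weight \<open>4 ^ n\<close> and above do not change the residue modulo \<open>4 ^ n\<close>.
\<close>
lemma residue_class_refine:
  "residue_class n j \<noteq> {} \<Longrightarrow>
   (\<lambda>(d, e). d + 4 ^ n * e) ` (residue_class n j \<times> sums4 x y k) = (\<Union>a<4 ^ k. residue_class (n + k) (j + 4 ^ n * a))"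
proof (intro equalityI subsetI)
  fix u assume "u \<in> (\<lambda>(d, e). d + 4 ^ n * e) ` (residue_class n j \<times> sums4 x y k)"
  then obtain d e where d: "d \<in> sums4 x y n" "d mod 4 ^ n = j" "e \<in> sums4 x y k" "u = d + 4 ^ n * e"
    by (auto simp: residue_class_def)
  have "u \<in> sums4 x y (n + k)" unfolding sums4_add using d by force
  moreover have "u mod 4 ^ (n + k) = j + 4 ^ n * (u div 4 ^ n mod 4 ^ k)"
    using d(2) unfolding power_add mod_mult2_eq d(4) by simp
  ultimately show "u \<in> (\<Union>a<4 ^ k. residue_class (n + k) (j + 4 ^ n * a))"
    by (intro UN_I[of "u div 4 ^ n mod 4 ^ k"]) (auto simp: residue_class_def)
next
  assume "residue_class n j \<noteq> {}"
  then have j: "j < 4 ^ n" by (auto simp: residue_class_def)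
  fix u assume "u \<in> (\<Union>a<4 ^ k. residue_class (n + k) (j + 4 ^ n * a))"
  then obtain a where u: "u \<in> sums4 x y (n + k)" "u mod 4 ^ (n + k) = j + 4 ^ n * a"
    by (auto simp: residue_class_def)
  obtain d e where d: "d \<in> sums4 x y n" "e \<in> sums4 x y k" "u = d + 4 ^ n * e"
    using u(1) unfolding sums4_add by auto
  have "d mod 4 ^ n = u mod 4 ^ n" unfolding d(3) by simp
  also have "\<dots> = u mod 4 ^ (n + k) mod 4 ^ n" by (simp add: power_add mod_mult2_eq)
  also have "\<dots> = j" unfolding u(2) using j by simp
  finally show "u \<in> (\<lambda>(d, e). d + 4 ^ n * e) ` (residue_class n j \<times> sums4 x y k)"
    using d by (force simp: residue_class_def)
qed

text \<open>
  The class has \<open>card (residue_class n j) * 4 ^ k\<close> continuations by \<open>k\<close> digits. They fall into \<open>4 ^ k\<close> residue classes, none of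
  which is larger than the given one, so all are equally large.
\<close>
lemma maximal_residue_class_equidistributed:
  assumes max: "\<And>n' j'. card (residue_class n' j') \<le> card (residue_class n j)"
    and "residue_class n j \<noteq> {}" "a < 4 ^ k"
  shows "card (residue_class (n + k) (j + 4 ^ n * a)) = card (residue_class n j)"
proof -
  define c where "c a = card (residue_class (n + k) (j + 4 ^ n * a))" for a
  have fin: "finite (residue_class n j)" for n j by (simp add: residue_class_def)
  have "inj_on (\<lambda>(d, e). d + 4 ^ n * e) (residue_class n j \<times> sums4 x y k)"
    by (rule inj_on_subset[OF sums4_inj]) (auto simp: residue_class_def)
  from card_image[OF this]
  have "card ((\<lambda>(d, e). d + 4 ^ n * e) ` (residue_class n j \<times> sums4 x y k)) = card (residue_class n j) * 4 ^ k"
    by (simp add: full card_cartesian_product)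
  moreover have "card (\<Union>a<4 ^ k. residue_class (n + k) (j + 4 ^ n * a)) = (\<Sum>a<4 ^ k. c a)"
    unfolding c_def by (rule card_UN_disjoint) (auto simp: fin, auto simp: residue_class_def)
  ultimately have "(\<Sum>a<4 ^ k. c a) = (\<Sum>a<(4::nat) ^ k. card (residue_class n j))"
    using residue_class_refine[OF assms(2), of k] by (simp add: mult.commute)
  moreover have "c a \<le> card (residue_class n j)" for a using max by (simp add: c_def)
  ultimately have "c a = card (residue_class n j)"
    using assms(3) sum_mono_inv[of c "{..<4 ^ k}" "\<lambda>_. card (residue_class n j)" a] by simp
  then show ?thesis by (simp add: c_def)
qed

text \<open>
  Summed over all continuations, equidistribution leaves a full geometric sum of roots of unity, which is \<open>0\<close>. The same sum
  factors into the sum over the class and the generating sum of the \<open>k\<close> new digits, which is not \<open>0\<close>.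
\<close>
lemma maximal_residue_class_sum_zero:
  assumes max: "\<And>n' j'. card (residue_class n' j') \<le> card (residue_class n j)"
    and "residue_class n j \<noteq> {}" "k \<ge> 1"
    and xy: "x = 4 ^ p * x'" "odd x'" "y = 4 ^ q * y'" "odd y'"
  shows "(\<Sum>d\<in>residue_class n j. cis (2 * pi / 4 ^ (n + k)) ^ d) = 0"
proof -
  define \<zeta> where "\<zeta> = cis (2 * pi / 4 ^ (n + k))"
  have fin: "finite (residue_class n j)" for n j by (simp add: residue_class_def)
  have "real (4 ^ n) * (2 * pi / 4 ^ (n + k)) = 2 * pi / 4 ^ k" by (simp add: power_add)
  then have \<zeta>n: "\<zeta> ^ 4 ^ n = cis (2 * pi / 4 ^ k)" unfolding \<zeta>_def Complex.DeMoivre by (rule arg_cong)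
  have "real (4 ^ (n + k)) * (2 * pi / 4 ^ (n + k)) = 2 * pi" by simp
  then have \<zeta>nk: "\<zeta> ^ 4 ^ (n + k) = 1" unfolding \<zeta>_def Complex.DeMoivre by simp
  have "(\<Sum>d\<in>residue_class n j. \<zeta> ^ d) * (\<Sum>e\<in>sums4 x y k. cis (2 * pi / 4 ^ k) ^ e) =
      (\<Sum>u\<in>(\<lambda>(d, e). d + 4 ^ n * e) ` (residue_class n j \<times> sums4 x y k). \<zeta> ^ u)"
  proof -
    have "inj_on (\<lambda>(d, e). d + 4 ^ n * e) (residue_class n j \<times> sums4 x y k)"
      by (rule inj_on_subset[OF sums4_inj]) (auto simp: residue_class_def)
    then show ?thesis
      by (simp add: sum.reindex sum_product sum.cartesian_product case_prod_unfold power_add power_mult \<zeta>n)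
  qed
  also have "\<dots> = (\<Sum>a<4 ^ k. \<Sum>u\<in>residue_class (n + k) (j + 4 ^ n * a). \<zeta> ^ u)"
    unfolding residue_class_refine[OF assms(2)]
    by (rule sum.UNION_disjoint) (auto simp: fin, auto simp: residue_class_def)
  also have "\<dots> = (\<Sum>a<(4::nat) ^ k. of_nat (card (residue_class n j)) * (\<zeta> ^ j * (\<zeta> ^ 4 ^ n) ^ a))"
  proof (rule sum.cong[OF refl])
    fix a :: nat assume "a \<in> {..<4 ^ k}"
    have "\<zeta> ^ u = \<zeta> ^ j * (\<zeta> ^ 4 ^ n) ^ a" if "u \<in> residue_class (n + k) (j + 4 ^ n * a)" for u
    proof -
      have "\<zeta> ^ u = \<zeta> ^ (4 ^ (n + k) * (u div 4 ^ (n + k)) + u mod 4 ^ (n + k))" by simp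
      also have "\<dots> = \<zeta> ^ (u mod 4 ^ (n + k))" unfolding power_add[of \<zeta>] power_mult \<zeta>nk by simp
      finally show ?thesis using that by (simp add: residue_class_def power_add power_mult)
    qed
    then show "(\<Sum>u\<in>residue_class (n + k) (j + 4 ^ n * a). \<zeta> ^ u) =
        of_nat (card (residue_class n j)) * (\<zeta> ^ j * (\<zeta> ^ 4 ^ n) ^ a)"
      using maximal_residue_class_equidistributed[OF max assms(2)] \<open>a \<in> _\<close> by simp
  qed
  also have "\<dots> = of_nat (card (residue_class n j)) * \<zeta> ^ j * (\<Sum>a<4 ^ k. (\<zeta> ^ 4 ^ n) ^ a)"
    by (simp add: sum_distrib_left mult.assoc)
  also have "(\<Sum>a<(4::nat) ^ k. (\<zeta> ^ 4 ^ n) ^ a) = 0"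
  proof -
    have "\<zeta> ^ 4 ^ n \<noteq> 1"
    proof
      assume "\<zeta> ^ 4 ^ n = 1"
      then have "cos (2 * pi / 4 ^ k) = 1" unfolding \<zeta>n by (metis cis.simps(1) one_complex.simps(1))
      moreover have "(4 :: real) ^ 1 \<le> 4 ^ k" using assms(3) by (intro power_increasing) auto
      then have "0 < 2 * pi / 4 ^ k" "2 * pi / 4 ^ k \<le> pi" by (auto simp: field_simps)
      then have "cos (2 * pi / 4 ^ k) < cos 0" by (intro cos_monotone_0_pi) auto
      ultimately show False by simp
    qed
    moreover have "(\<zeta> ^ 4 ^ n) ^ 4 ^ k = 1" using \<zeta>nk by (simp add: power_mult[symmetric] power_add)
    ultimately show ?thesis by (simp add: geometric_sum)
  qed
  finally show ?thesis using generating_sum_nonzero[OF xy, of k] unfolding \<zeta>_def by simp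
qed

text \<open>
  As \<open>k\<close> tends to infinity all summands tend to \<open>1\<close>, so the vanishing sums tend to the positive size of the
  class.
\<close>
lemma full_contradiction:
  assumes xy: "x = 4 ^ p * x'" "odd x'" "y = 4 ^ q * y'" "odd y'"
  shows False
proof -
  obtain n j where nj: "card (residue_class n j) \<ge> 1"
    "\<And>n' j'. card (residue_class n' j') \<le> card (residue_class n j)" by (rule maximal_residue_class) blast
  then have "residue_class n j \<noteq> {}" by auto
  have "(\<lambda>k. \<Sum>d\<in>residue_class n j. cis (2 * pi / 4 ^ (n + k)) ^ d) \<longlonglongrightarrow> (\<Sum>d\<in>residue_class n j. cis 0 ^ d)"
  proof (intro tendsto_sum tendsto_power)
    have "(\<lambda>k. 2 * pi / 4 ^ n * (1 / 4) ^ k) \<longlonglongrightarrow> 2 * pi / 4 ^ n * 0"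
      by (intro tendsto_mult tendsto_const LIMSEQ_realpow_zero) auto
    then have "(\<lambda>k. 2 * pi / 4 ^ (n + k)) \<longlonglongrightarrow> 0" by (simp add: power_add power_one_over)
    then show "(\<lambda>k. cis (2 * pi / 4 ^ (n + k))) \<longlonglongrightarrow> cis 0" by (intro tendsto_cis)
  qed
  moreover have "\<forall>\<^sub>F k in sequentially. (\<Sum>d\<in>residue_class n j. cis (2 * pi / 4 ^ (n + k)) ^ d) = 0"
    using maximal_residue_class_sum_zero[OF nj(2) \<open>residue_class n j \<noteq> {}\<close> _ xy]
    by (intro eventually_sequentiallyI[of 1])
  ultimately have "(\<Sum>d\<in>residue_class n j. cis 0 ^ d) = 0"
    by (metis LIMSEQ_unique tendsto_eventually)
  then have "of_nat (card (residue_class n j)) = (0 :: complex)" by simp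
  then show False using nj(1) by simp
qed

end

text \<open>
  The common factor \<open>c\<close> makes the lemma cover two odd exponents of \<open>2\<close> as well, with \<open>c = 2\<close>: scaling by \<open>c\<close> does not
  affect coincidences.
\<close>
lemma coinciding_sums:
  assumes "x = c * (4 ^ p * x')" "odd x'" "y = c * (4 ^ q * y')" "odd y'" "c \<noteq> 0"
  obtains n where "n \<ge> 1" "card (sums4 x y n) < 4 ^ n"
proof -
  let ?x = "4 ^ p * x'" and ?y = "4 ^ q * y'"
  obtain n where n: "card (sums4 ?x ?y n) \<noteq> 4 ^ n"
    using full_contradiction[of ?x ?y p x' q y'] assms by blast
  have "inj_on ((*) c) (sums4 ?x ?y n)" using assms(5) by (intro inj_onI) simp
  then have "card (sums4 x y n) = card (sums4 ?x ?y n)"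
    unfolding assms(1,3) sums4_mult by (rule card_image)
  then have "card (sums4 x y n) < 4 ^ n" using n card_sums4_le[of ?x ?y n] by linarith
  moreover have "n \<noteq> 0" using n by (intro notI) simp
  ultimately show thesis using that[of n] by simp
qed

section \<open>Measure and Hausdorff dimension\<close>

lemma card_sums4_mult_le: "card (sums4 x y (n * k)) \<le> card (sums4 x y n) ^ k"
proof (induction k)
  case (Suc k)
  have "card (sums4 x y (n * Suc k)) \<le> card (sums4 x y n \<times> sums4 x y (n * k))"
    unfolding mult_Suc_right sums4_add by (intro card_image_le) simp
  also have "\<dots> \<le> card (sums4 x y n) * card (sums4 x y n) ^ k"
    unfolding card_cartesian_product using Suc by simp
  finally show ?case by simp
qed simp

lemma E_cover: "E x y \<subseteq> (\<Union>d\<in>sums4 x y m. {real d / 4 ^ m..real d / 4 ^ m + (real x + real y) / 4 ^ m})"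
proof
  fix z assume "z \<in> E x y"
  then obtain d e where d: "d \<in> sums4 x y m" "e \<in> E x y" "z = (real d + e) / 4 ^ m" by (rule E_levelE)
  have "(real x + real y) / 3 \<le> real x + real y" by simp
  then have "0 \<le> e" "e \<le> real x + real y" using E_bounds[OF d(2)] by linarith+
  then have "0 \<le> e / 4 ^ m" "e / 4 ^ m \<le> (real x + real y) / 4 ^ m"
    by (simp, intro divide_right_mono) simp_all
  moreover have "z = real d / 4 ^ m + e / 4 ^ m" unfolding d(3) by (rule add_divide_distrib)
  ultimately have "z \<in> {real d / 4 ^ m..real d / 4 ^ m + (real x + real y) / 4 ^ m}" by simp
  then show "z \<in> (\<Union>d\<in>sums4 x y m. {real d / 4 ^ m..real d / 4 ^ m + (real x + real y) / 4 ^ m})"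
    using d(1) by blast
qed

text \<open>
  The copies of level \<open>n * k\<close> have total length at most a constant times \<open>(card (sums4 x y n) / 4 ^ n) ^ k\<close>, which
  tends to \<open>0\<close>.
\<close>
lemma E_thin:
  assumes few: "card (sums4 x y n) < 4 ^ n" and "u < v"
  shows "\<exists>z. u < z \<and> z < v \<and> z \<notin> E x y"
proof (rule ccontr)
  assume "\<not> ?thesis"
  then have sub: "{u<..<v} \<subseteq> E x y" by auto
  define c where "c = real x + real y"
  define \<rho> where "\<rho> = real (card (sums4 x y n)) / 4 ^ n"
  have \<rho>: "0 \<le> \<rho>" "\<rho> < 1" using of_nat_less_iff[of "card (sums4 x y n)" "4 ^ n", where 'a = real] few by (simp_all add: \<rho>_def)
  have "v - u \<le> c * \<rho> ^ k" for k
  proof -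
    define m where "m = n * k"
    define J where "J d = {real d / 4 ^ m..real d / 4 ^ m + c / 4 ^ m}" for d
    have "v - u = measure lborel {u<..<v}" using assms(2) by simp
    also have "\<dots> \<le> measure lborel (\<Union>d\<in>sums4 x y m. J d)"
    proof (rule measure_mono_fmeasurable)
      show "{u<..<v} \<subseteq> (\<Union>d\<in>sums4 x y m. J d)"
        using sub E_cover[of x y m] unfolding J_def c_def by (rule subset_trans)
      have "J d \<in> fmeasurable lborel" for d
        unfolding J_def by (rule fmeasurableI) (simp_all add: emeasure_lborel_Icc_eq)
      then show "(\<Union>d\<in>sums4 x y m. J d) \<in> fmeasurable lborel" by (intro fmeasurable.finite_UN) auto
    qed simp
    also have "\<dots> \<le> (\<Sum>d\<in>sums4 x y m. measure lborel (J d))"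
      by (rule measure_UNION_le) (auto simp: J_def)
    also have "\<dots> = real (card (sums4 x y m)) * (c / 4 ^ m)" by (simp add: J_def c_def)
    also have "\<dots> \<le> real (card (sums4 x y n) ^ k) * (c / 4 ^ m)"
      unfolding m_def using card_sums4_mult_le[of x y n k] by (intro mult_right_mono) (auto simp: c_def simp del: of_nat_power)
    also have "\<dots> = c * \<rho> ^ k" by (simp add: \<rho>_def m_def power_mult power_divide)
    finally show ?thesis .
  qed
  moreover have "(\<lambda>k. c * \<rho> ^ k) \<longlonglongrightarrow> c * 0"
    using \<rho> by (intro tendsto_mult tendsto_const LIMSEQ_realpow_zero)
  ultimately have "v - u \<le> c * 0" by (intro LIMSEQ_le_const) auto
  then show False using assms(2) by simp
qed

lemma hausdorff_premeasure_E_le: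
  assumes "0 < s" "(real x + real y) / 4 ^ m \<le> \<delta>"
  shows "hausdorff_premeasure s \<delta> (E x y) \<le> ennreal (real (card (sums4 x y m)) * ((real x + real y) / 4 ^ m) powr s)"
proof -
  define c where "c = (real x + real y) / 4 ^ m"
  have "0 \<le> c" by (simp add: c_def)
  obtain h where h: "bij_betw h {0..<card (sums4 x y m)} (sums4 x y m)"
    using ex_bij_betw_nat_finite finite_sums4 by blast
  define U where "U i = (if i < card (sums4 x y m) then {real (h i) / 4 ^ m..real (h i) / 4 ^ m + c} else {})" for i
  have diam: "diameter {a..a + c} = c" for a :: real using \<open>0 \<le> c\<close> by (simp add: diameter_closed_interval)
  have "E x y \<subseteq> (\<Union>i. U i)"
  proof
    fix z assume "z \<in> E x y"
    then obtain d where "d \<in> sums4 x y m" "z \<in> {real d / 4 ^ m..real d / 4 ^ m + c}"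
      using E_cover[of x y m] unfolding c_def by blast
    moreover from this(1) obtain i where "i < card (sums4 x y m)" "d = h i"
      using bij_betw_imp_surj_on[OF h] by (metis atLeast0LessThan imageE lessThan_iff)
    ultimately show "z \<in> (\<Union>i. U i)" by (auto simp: U_def)
  qed
  moreover have "\<forall>i. bounded (U i) \<and> diameter (U i) \<le> \<delta>"
    using assms(2) diam \<open>0 \<le> c\<close> by (auto simp: U_def simp flip: c_def)
  ultimately have "hausdorff_premeasure s \<delta> (E x y) \<le> (\<Sum>i. ennreal (diam_pow s (U i)))"
    unfolding hausdorff_premeasure_def by (intro INF_lower) simp
  also have "\<dots> = (\<Sum>i<card (sums4 x y m). ennreal (diam_pow s (U i)))"
    by (rule suminf_finite) (auto simp: U_def diam_pow_def)
  also have "\<dots> = (\<Sum>i<card (sums4 x y m). ennreal (c powr s))"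
    using \<open>0 < s\<close> diam \<open>0 \<le> c\<close> by (intro sum.cong) (auto simp: U_def diam_pow_def)
  also have "\<dots> = ennreal (real (card (sums4 x y m)) * c powr s)"
    by (simp add: ennreal_mult ennreal_of_nat_eq_real_of_nat)
  finally show ?thesis unfolding c_def .
qed

lemma power_powr:
  fixes A :: real
  assumes "0 < A"
  shows "(A ^ k) powr s = (A powr s) ^ k"
  using assms by (induction k) (simp_all add: powr_mult)

text \<open>
  The same covers as for Lebesgue measure, with lengths raised to the power \<open>s\<close>: the cover of level \<open>n * k\<close> contributes a constant
  times \<open>q ^ k\<close>, where \<open>q = card (sums4 x y n) / (4 ^ n) powr s < 1\<close>.
\<close>
lemma hausdorff_measure_E_zero:
  assumes "n \<ge> 1" "0 < s" "real (card (sums4 x y n)) < (4 ^ n) powr s"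
  shows "hausdorff_measure s (E x y) = 0"
proof -
  define c where "c = real x + real y"
  define q where "q = real (card (sums4 x y n)) / (4 ^ n) powr s"
  have q: "0 \<le> q" "q < 1" using assms(3) by (auto simp: q_def)
  have "hausdorff_premeasure s \<delta> (E x y) \<le> 0" if \<delta>: "0 < \<delta>" for \<delta>
  proof (rule tendsto_lowerbound)
    have "(\<lambda>k. c powr s * q ^ k) \<longlonglongrightarrow> c powr s * 0"
      using q by (intro tendsto_mult tendsto_const LIMSEQ_realpow_zero)
    then show "(\<lambda>k. ennreal (c powr s * q ^ k)) \<longlonglongrightarrow> 0"
      using tendsto_ennrealI by fastforce
    have "(\<lambda>k. c * (1 / 4 ^ n) ^ k) \<longlonglongrightarrow> c * 0"
      using assms(1) by (intro tendsto_mult tendsto_const LIMSEQ_realpow_zero) auto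
    then have "\<forall>\<^sub>F k in sequentially. c * (1 / 4 ^ n) ^ k < \<delta>"
      using \<delta> by (intro order_tendstoD) auto
    then show "\<forall>\<^sub>F k in sequentially. hausdorff_premeasure s \<delta> (E x y) \<le> ennreal (c powr s * q ^ k)"
    proof (rule eventually_mono)
      fix k assume "c * (1 / 4 ^ n) ^ k < \<delta>"
      then have "(real x + real y) / 4 ^ (n * k) \<le> \<delta>" by (simp add: c_def power_mult power_one_over)
      from hausdorff_premeasure_E_le[OF assms(2) this]
      have "hausdorff_premeasure s \<delta> (E x y) \<le> ennreal (real (card (sums4 x y (n * k))) * (c / 4 ^ (n * k)) powr s)"
        unfolding c_def .
      also have "\<dots> \<le> ennreal (real (card (sums4 x y n) ^ k) * (c / 4 ^ (n * k)) powr s)"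
        using card_sums4_mult_le[of x y n k] by (intro ennreal_leI mult_right_mono) (auto simp del: of_nat_power)
      also have "real (card (sums4 x y n) ^ k) * (c / 4 ^ (n * k)) powr s = c powr s * q ^ k"
        unfolding power_mult powr_divide power_powr[OF zero_less_power[OF zero_less_numeral]] by (simp add: q_def power_divide)
      finally show "hausdorff_premeasure s \<delta> (E x y) \<le> ennreal (c powr s * q ^ k)" .
    qed
  qed simp
  then show ?thesis unfolding hausdorff_measure_def by (intro antisym SUP_least) auto
qed

definition doubling :: "real \<Rightarrow> real" where
  "doubling t = (if t < 1 / 2 then 2 * t else 2 * t - 1)"

definition binary_digit :: "real \<Rightarrow> nat" where
  "binary_digit t = (if t < 1 / 2 then 0 else 1)"

text \<open>
  Reads the binary expansion of a number in \<open>{0..<1}\<close> in base \<open>4\<close>. The binary digits are obtained by iterating the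
  doubling map, which makes the functional equation in \<open>spread_step\<close> immediate.
\<close>
definition spread :: "real \<Rightarrow> real" where
  "spread t = (\<Sum>n. real (binary_digit ((doubling ^^ n) t)) / 4 ^ Suc n)"

lemma binary_digit_mem: "binary_digit t \<in> digits 1 0"
  by (simp add: binary_digit_def digits_def)

lemma spread_mem: "spread t \<in> E 1 0"
  unfolding spread_def by (intro E_I binary_digit_mem)

lemma spread_step: "spread t = (real (binary_digit t) + spread (doubling t)) / 4"
  unfolding spread_def
  by (subst base4_series_Cons[OF digit_le[OF binary_digit_mem]]) (simp add: funpow_swap1)

text \<open>
  The estimate is invariant under removing a common leading digit, as this multiplies \<open>(t - s)\<^sup>2\<close> and the difference of the values by
  the same factor \<open>4\<close>. If the leading digits differ, the values differ by at least \<open>(1 - 1/3) / 4 = 1/6\<close>. The exponent \<open>n\<close> bounds the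
  number of common digits and serves only for the induction.
\<close>
lemma spread_separates:
  assumes "0 \<le> s" "t < 1" "(1 / 2) ^ n \<le> t - s"
  shows "(t - s)\<^sup>2 / 6 \<le> spread t - spread s"
  using assms
proof (induction n arbitrary: s t)
  case (Suc n)
  have lt: "s < t" using Suc.prems(3) by (smt (verit) zero_less_power zero_less_divide_1_iff)
  show ?case
  proof (cases "binary_digit s = binary_digit t")
    case True
    then have d: "doubling t - doubling s = 2 * (t - s)"
      by (auto simp: binary_digit_def doubling_def split: if_splits)
    have IH: "(doubling t - doubling s)\<^sup>2 / 6 \<le> spread (doubling t) - spread (doubling s)"
    proof (rule Suc.IH)
      show "0 \<le> doubling s" "doubling t < 1" using Suc.prems lt by (auto simp: doubling_def)
      show "(1 / 2) ^ n \<le> doubling t - doubling s" unfolding d using Suc.prems(3) by simp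
    qed
    define q where "q = (t - s)\<^sup>2"
    have "(2 * (t - s))\<^sup>2 = 4 * (t - s)\<^sup>2" by (simp only: power_mult_distrib) simp
    then have "4 * q / 6 \<le> spread (doubling t) - spread (doubling s)" using IH unfolding d q_def by simp
    moreover have "spread t - spread s = (spread (doubling t) - spread (doubling s)) / 4"
      unfolding spread_step[of s] spread_step[of t] True by (simp add: field_simps)
    ultimately show ?thesis unfolding q_def[symmetric] by simp
  next
    case False
    then have "binary_digit s = 0" "binary_digit t = 1" using lt by (auto simp: binary_digit_def split: if_splits)
    moreover have "0 \<le> spread (doubling t)" "spread (doubling s) \<le> 1 / 3"
      using E_bounds[OF spread_mem] by auto
    ultimately have "1 / 6 \<le> spread t - spread s" unfolding spread_step[of s] spread_step[of t] by (simp add: field_simps)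
    moreover have "(t - s)\<^sup>2 \<le> 1" using lt Suc.prems(1,2) by (intro power_le_one) auto
    ultimately show ?thesis by linarith
  qed
qed simp

lemma sqrt_diameter_le_diam_pow:
  fixes U :: "'a :: metric_space set"
  assumes "bounded U" "diameter U \<le> 1" "U \<noteq> {}" "0 \<le> s" "s \<le> 1 / 2"
  shows "sqrt (diameter U) \<le> diam_pow s U"
proof (cases "s = 0")
  case True
  then show ?thesis using assms by (simp add: diam_pow_def)
next
  case False
  have "0 \<le> diameter U" using assms(1) by (rule diameter_ge_0)
  then have "sqrt (diameter U) = diameter U powr (1 / 2)" by (simp add: powr_half_sqrt)
  also have "\<dots> \<le> diameter U powr s" using assms \<open>0 \<le> diameter U\<close> by (intro powr_mono') auto
  finally show ?thesis using False assms(3) by (simp add: diam_pow_def)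
qed

text \<open>
  Pulled back along \<open>spread\<close>, a set of diameter \<open>\<delta>\<close> fits into an interval of length \<open>2 * sqrt (6 * \<delta>)\<close>. The
  pulled-back sets cover an interval of length \<open>1\<close>.
\<close>
lemma hausdorff_cover_sum_ge:
  assumes "x \<ge> 1" "0 \<le> s" "s \<le> 1 / 2"
    and cover: "E x y \<subseteq> (\<Union>i. U i)" and small: "\<And>i. bounded (U i) \<and> diameter (U i) \<le> 1"
  shows "1 \<le> ennreal (2 * sqrt 6) * (\<Sum>i. ennreal (diam_pow s (U i)))"
proof -
  define h where "h t = real x * spread t" for t
  have h_mem: "h t \<in> E x y" for t
    unfolding h_def E_iff[of _ x y] using spread_mem zero_in_E by (intro bexI[of _ "spread t"] bexI[of _ 0]) auto
  have close: "\<bar>t - t'\<bar> \<le> sqrt (6 * diameter (U i))"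
    if "t \<in> {0..<1}" "t' \<in> {0..<1}" "h t \<in> U i" "h t' \<in> U i" for t t' i
  proof -
    have sep: "(t - s)\<^sup>2 / 6 \<le> \<bar>h t - h s\<bar>" if "0 \<le> s" "s < t" "t < 1" for s t
    proof -
      obtain n where "(1 / 2 :: real) ^ n < t - s" using real_arch_pow_inv[of "t - s" "1/2"] \<open>s < t\<close> by auto
      then have "(t - s)\<^sup>2 / 6 \<le> spread t - spread s" using that by (intro spread_separates[of s t n]) auto
      also have "\<dots> \<le> \<bar>spread t - spread s\<bar>" by simp
      also have "\<dots> \<le> real x * \<bar>spread t - spread s\<bar>" using assms(1) by (simp add: mult_le_cancel_right1)
      also have "\<dots> = \<bar>h t - h s\<bar>" by (simp add: h_def abs_mult flip: right_diff_distrib)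
      finally show ?thesis .
    qed
    have "(t - t')\<^sup>2 / 6 \<le> \<bar>h t - h t'\<bar>"
      using sep[of t' t] sep[of t t'] that(1,2)
      by (cases t t' rule: linorder_cases) (auto simp: power2_commute abs_minus_commute)
    also have "\<dots> \<le> diameter (U i)"
      using diameter_bounded_bound[of "U i" "h t" "h t'"] small that by (simp add: dist_real_def)
    finally have "(t - t')\<^sup>2 \<le> 6 * diameter (U i)" by simp
    then show ?thesis using real_sqrt_le_mono by fastforce
  qed
  define J where "J i = (if \<exists>t\<in>{0..<1}. h t \<in> U i
      then let t = SOME t. t \<in> {0..<1} \<and> h t \<in> U i; \<rho> = sqrt (6 * diameter (U i)) in {t - \<rho>..t + \<rho>} else {})" for i
  have J: "t \<in> J i" if "t \<in> {0..<1}" "h t \<in> U i" for t i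
  proof -
    define t0 where "t0 = (SOME t. t \<in> {0..<1} \<and> h t \<in> U i)"
    have "t0 \<in> {0..<1} \<and> h t0 \<in> U i" unfolding t0_def by (rule someI[of _ t]) (use that in blast)
    then have "\<bar>t - t0\<bar> \<le> sqrt (6 * diameter (U i))" using close[of t t0 i] that by blast
    then have "t \<in> {t0 - sqrt (6 * diameter (U i))..t0 + sqrt (6 * diameter (U i))}" by auto
    then show ?thesis using that unfolding J_def t0_def Let_def by auto
  qed
  have size: "emeasure lborel (J i) \<le> ennreal (2 * sqrt 6) * ennreal (diam_pow s (U i))" for i
  proof (cases "\<exists>t\<in>{0..<1}. h t \<in> U i")
    case True
    then have "U i \<noteq> {}" by auto
    have "0 \<le> diameter (U i)" using small by (intro diameter_ge_0) blast
    then have "emeasure lborel (J i) = ennreal (2 * sqrt 6 * sqrt (diameter (U i)))"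
      using True by (simp add: J_def Let_def real_sqrt_mult)
    also have "\<dots> \<le> ennreal (2 * sqrt 6 * diam_pow s (U i))"
      using sqrt_diameter_le_diam_pow[OF _ _ \<open>U i \<noteq> {}\<close> assms(2,3)] small
      by (intro ennreal_leI mult_left_mono) auto
    also have "\<dots> = ennreal (2 * sqrt 6) * ennreal (diam_pow s (U i))" by (rule ennreal_mult') simp
    finally show ?thesis .
  qed (simp add: J_def)
  have "1 = emeasure lborel {0..<1 :: real}" by simp
  also have "\<dots> \<le> emeasure lborel (\<Union>i. J i)"
  proof (rule emeasure_mono)
    show "{0..<1} \<subseteq> (\<Union>i. J i)"
    proof
      fix t :: real assume t: "t \<in> {0..<1}"
      then obtain i where "h t \<in> U i" using h_mem[of t] cover by blast
      then show "t \<in> (\<Union>i. J i)" using J[OF t] by blast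
    qed
  qed (auto simp: J_def Let_def)
  also have "\<dots> \<le> (\<Sum>i. emeasure lborel (J i))"
    by (rule emeasure_subadditive_countably) (auto simp: J_def Let_def)
  also have "\<dots> \<le> (\<Sum>i. ennreal (2 * sqrt 6) * ennreal (diam_pow s (U i)))"
    by (intro suminf_le size) auto
  finally show ?thesis by simp
qed

lemma hausdorff_measure_E_pos:
  assumes "x \<ge> 1" "0 \<le> s" "s \<le> 1 / 2"
  shows "hausdorff_measure s (E x y) \<noteq> 0"
proof
  assume "hausdorff_measure s (E x y) = 0"
  then have "hausdorff_premeasure s 1 (E x y) \<le> 0"
    unfolding hausdorff_measure_def by (metis SUP_upper greaterThan_iff zero_less_one)
  then have "hausdorff_premeasure s 1 (E x y) < ennreal (1 / (2 * sqrt 6))"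
    by (simp add: ennreal_less_zero_iff le_less_trans)
  then obtain U where U: "E x y \<subseteq> (\<Union>i. U i)" "\<And>i. bounded (U i) \<and> diameter (U i) \<le> 1"
    "(\<Sum>i. ennreal (diam_pow s (U i))) < ennreal (1 / (2 * sqrt 6))"
    unfolding hausdorff_premeasure_def INF_less_iff by blast
  have "(\<Sum>i. ennreal (diam_pow s (U i))) < top" using U(3) by (rule less_trans) simp
  then obtain r where r: "0 \<le> r" "(\<Sum>i. ennreal (diam_pow s (U i))) = ennreal r"
    by (metis ennreal_cases less_irrefl)
  have "r < 1 / (2 * sqrt 6)" using U(3) unfolding r(2) by (simp add: ennreal_less_iff r(1))
  then have "2 * sqrt 6 * r < 1" by (simp add: field_simps)
  then have "ennreal (2 * sqrt 6 * r) < 1" by (simp add: ennreal_less_one_iff)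
  moreover have "1 \<le> ennreal (2 * sqrt 6 * r)"
    using hausdorff_cover_sum_ge[OF assms U(1,2)] unfolding r(2) by (simp add: ennreal_mult' r(1))
  ultimately show False by (meson not_le)
qed

lemma hausdorff_dim_E_noninteger:
  assumes "x \<ge> 1" "n \<ge> 1" and few: "card (sums4 x y n) < 4 ^ n"
  shows "\<exists>d::real. hausdorff_dim (E x y) = ereal d \<and> d \<notin> \<int>"
proof -
  define N where "N = real (card (sums4 x y n))"
  have "0 \<in> sums4 x y n"
    by (induction n) (force simp: digits_def)+
  then have "card (sums4 x y n) \<noteq> 0" by auto
  then have "1 \<le> N" unfolding N_def by linarith
  have "N < 4 ^ n" using of_nat_less_iff[of "card (sums4 x y n)" "4 ^ n", where 'a = real] few by (simp add: N_def)
  have one: "1 < (4 :: real) ^ n" using assms(2) by (intro one_less_power) auto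
  define a where "a = log (4 ^ n) N"
  \<comment> \<open>Any s strictly between the similarity dimension a and 1 will do.\<close>
  define s where "s = (a + 1) / 2"
  have "0 \<le> a" "a < 1" using \<open>1 \<le> N\<close> \<open>N < 4 ^ n\<close> one by (simp_all add: a_def log_less_one_cancel_iff)
  then have s: "0 < s" "a < s" "s < 1" by (simp_all add: s_def)
  have "N = (4 ^ n) powr a" using \<open>1 \<le> N\<close> one by (simp add: a_def)
  also have "\<dots> < (4 ^ n) powr s" using s(2) one by (intro powr_less_mono)
  finally have "hausdorff_measure s (E x y) = 0"
    using assms(2) s(1) by (intro hausdorff_measure_E_zero[of n]) (simp_all add: N_def)
  then have upper: "hausdorff_dim (E x y) \<le> ereal s"
    unfolding hausdorff_dim_def using s(1) by (intro INF_lower) simp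
  have lower: "ereal (1 / 2) \<le> hausdorff_dim (E x y)"
    unfolding hausdorff_dim_def
  proof (rule INF_greatest)
    fix r assume "r \<in> {s. 0 \<le> s \<and> hausdorff_measure s (E x y) = 0}"
    then have "\<not> r \<le> 1 / 2" using hausdorff_measure_E_pos[OF assms(1)] by blast
    then show "ereal (1 / 2) \<le> ereal r" by simp
  qed
  obtain d where d: "hausdorff_dim (E x y) = ereal d"
    using upper lower by (cases "hausdorff_dim (E x y)") auto
  then have "1 / 2 \<le> d" "d < 1" using upper lower s(3) by auto
  have "d \<notin> \<int>"
  proof
    assume "d \<in> \<int>"
    then obtain k :: int where "d = of_int k" by (rule Ints_cases)
    then have "0 < k" "k < 1" using \<open>1 / 2 \<le> d\<close> \<open>d < 1\<close> by linarith+
    then show False by simp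
  qed
  then show ?thesis using d by blast
qed

section \<open>The classification\<close>

lemma last_nonzero_digit4_factor:
  assumes "n > 0"
  obtains k m where "n = 4 ^ k * m" "m mod 4 = last_nonzero_digit4 n" "m mod 4 \<noteq> 0"
proof -
  have dvd: "4 ^ k dvd n" if "\<And>i. i < k \<Longrightarrow> base4_digit n i = 0" for k
    using that
  proof (induction k)
    case (Suc k)
    then have "4 ^ k dvd n" by simp
    moreover have "4 dvd n div 4 ^ k" using Suc.prems[of k] by (auto simp: base4_digit_def)
    ultimately show ?case by (auto elim!: dvdE)
  qed simp
  have "\<exists>k. base4_digit n k \<noteq> 0"
  proof (rule ccontr)
    assume "\<not> ?thesis"
    then have "4 ^ n dvd n" using dvd by blast
    then have "4 ^ n \<le> n" using assms by (rule dvd_imp_le)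
    then show False using less_exp[of n] power_mono[of "2 :: nat" 4 n] by linarith
  qed
  define k where "k = (LEAST k. base4_digit n k \<noteq> 0)"
  have "base4_digit n k \<noteq> 0" unfolding k_def using \<open>\<exists>k. _\<close> by (rule LeastI_ex)
  moreover have "4 ^ k dvd n"
    by (rule dvd) (use not_less_Least in \<open>force simp: k_def\<close>)
  moreover have "n div 4 ^ k mod 4 = last_nonzero_digit4 n"
    unfolding last_nonzero_digit4_def k_def[symmetric] by (simp add: base4_digit_def)
  ultimately show thesis by (intro that[of k "n div 4 ^ k"]) (auto simp: base4_digit_def)
qed

lemma V_factor:
  assumes "n \<in> V"
  obtains k m where "n = 4 ^ k * m" "odd m"
proof -
  have "n > 0" "last_nonzero_digit4 n \<in> {1, 3}" using assms by (auto simp: V_def)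
  moreover from this(1) obtain k m where m: "n = 4 ^ k * m" "m mod 4 = last_nonzero_digit4 n"
    by (rule last_nonzero_digit4_factor)
  ultimately have "m mod 4 = 1 \<or> m mod 4 = 3" by simp
  then have "odd m" by presburger
  then show thesis using m(1) that by blast
qed

lemma D_factor:
  assumes "n \<in> D"
  obtains k m where "n = 4 ^ k * (2 * m)" "odd m"
proof -
  have n: "n > 0" "last_nonzero_digit4 n \<noteq> 1" "last_nonzero_digit4 n \<noteq> 3" using assms by (auto simp: V_def D_def)
  obtain k m where m: "n = 4 ^ k * m" "m mod 4 = last_nonzero_digit4 n" "m mod 4 \<noteq> 0"
    by (rule last_nonzero_digit4_factor[OF n(1)])
  have "m mod 4 \<noteq> 1" "m mod 4 \<noteq> 3" unfolding m(2) by (rule n(2), rule n(3))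
  then have "m mod 4 = 2" using m(3) by presburger
  then have "m = 2 * (m div 2)" "odd (m div 2)" by presburger+
  then show thesis using m(1) that by metis
qed

lemma E_perfect:
  assumes "x \<ge> 1" "p \<in> E x y" "0 < e"
  shows "\<exists>q\<in>E x y. q \<noteq> p \<and> \<bar>q - p\<bar> < e"
proof -
  define c where "c = (real x + real y) / 3"
  have "0 < c" using assms(1) by (simp add: c_def)
  obtain n where n: "(1 / 4 :: real) ^ n < e / c"
    using real_arch_pow_inv[of "e / c" "1/4"] assms(3) \<open>0 < c\<close> by auto
  obtain d t where d: "d \<in> sums4 x y n" "t \<in> E x y" "p = (real d + t) / 4 ^ n" using assms(2) by (rule E_levelE)
  have "c \<in> E x y" using E_reflect[OF zero_in_E] by (simp add: c_def)
  then obtain t' where t': "t' \<in> E x y" "t' \<noteq> t" using zero_in_E[of x y] \<open>0 < c\<close> by (metis less_irrefl)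
  define q where "q = (real d + t') / 4 ^ n"
  have "t \<le> c" "t' \<le> c" using E_bounds(2)[OF d(2)] E_bounds(2)[OF t'(1)] unfolding c_def by blast+
  then have "\<bar>t' - t\<bar> \<le> c" using E_bounds(1)[OF d(2)] E_bounds(1)[OF t'(1)] by linarith
  have "q - p = (t' - t) * (1 / 4) ^ n" unfolding q_def d(3) by (simp add: field_simps power_one_over)
  then have "\<bar>q - p\<bar> = \<bar>t' - t\<bar> * (1 / 4) ^ n" by (simp add: abs_mult)
  also have "\<dots> \<le> c * (1 / 4) ^ n" using \<open>\<bar>t' - t\<bar> \<le> c\<close> by (intro mult_right_mono) auto
  also have "\<dots> < e" using n \<open>0 < c\<close> by (simp add: field_simps)
  finally have "\<bar>q - p\<bar> < e" .
  moreover have "q \<noteq> p" unfolding q_def d(3) using t'(2) by simp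
  moreover have "q \<in> E x y" unfolding q_def by (rule E_levelI[OF d(1) t'(1)])
  ultimately show ?thesis by blast
qed

lemma E_cantor_set:
  assumes "x \<ge> 1" "n \<ge> 1" "card (sums4 x y n) < 4 ^ n"
  shows "cantor_set (E x y)" "\<exists>d::real. hausdorff_dim (E x y) = ereal d \<and> d \<notin> \<int>"
proof -
  show "cantor_set (E x y)"
    by (rule cantor_set_criterion) (use compact_E zero_in_E E_perfect[OF assms(1)] E_thin[OF assms(3)] in blast)+
  show "\<exists>d::real. hausdorff_dim (E x y) = ereal d \<and> d \<notin> \<int>"
    by (rule hausdorff_dim_E_noninteger[OF assms])
qed

lemma interior_E_V_D:
  assumes "x \<in> V" "y \<in> D"
  shows "interior (E x y) \<noteq> {}"
proof -
  obtain p x' where "x = 4 ^ p * x'" "odd x'" using assms(1) by (rule V_factor)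
  moreover obtain q y' where "y = 4 ^ q * (2 * y')" "odd y'" using assms(2) by (rule D_factor)
  ultimately show ?thesis using interior_E_shift[OF interior_E_residues] by metis
qed

theorem theorem1p3:
  fixes x y :: nat
  assumes "x \<ge> 1" and "y \<ge> 1"
  shows
    "((x \<in> V \<and> y \<in> V) \<or> (x \<in> D \<and> y \<in> D) \<longrightarrow>
        cantor_set (E x y) \<and> (\<exists>d::real. hausdorff_dim (E x y) = ereal d \<and> d \<notin> \<int>))
     \<and>
     ((x \<in> V \<and> y \<in> D) \<or> (x \<in> D \<and> y \<in> V) \<longrightarrow>
        ((\<exists>F. finite F \<and> (\<forall>I\<in>F. closed_interval I) \<and> E x y = \<Union>F) \<or> cantorval (E x y))
        \<and>
        (\<forall>t::int. real y = 2 * 4 powi t * real x \<longrightarrow>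
           (\<exists>F. card F = 2 ^ (if t \<ge> 0 then nat t else nat (- t - 1))
                \<and> (\<forall>I\<in>F. closed_interval I) \<and> pairwise disjnt F \<and> E x y = \<Union>F))
        \<and>
        ((\<nexists>t::int. real y = 2 * 4 powi t * real x) \<longrightarrow> cantorval (E x y)))"
proof -
  have few_sums: "\<exists>n\<ge>1. card (sums4 x y n) < 4 ^ n" if "(x \<in> V \<and> y \<in> V) \<or> (x \<in> D \<and> y \<in> D)"
    using that
  proof
    assume xy: "x \<in> V \<and> y \<in> V"
    obtain p x' where "x = 1 * (4 ^ p * x')" "odd x'" using xy by (metis V_factor mult_1)
    moreover obtain q y' where "y = 1 * (4 ^ q * y')" "odd y'" using xy by (metis V_factor mult_1)
    ultimately show ?thesis using coinciding_sums[of x 1 p x' y q y'] by fastforce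
  next
    assume xy: "x \<in> D \<and> y \<in> D"
    obtain p x' where "x = 2 * (4 ^ p * x')" "odd x'" using xy by (metis D_factor mult.left_commute)
    moreover obtain q y' where "y = 2 * (4 ^ q * y')" "odd y'" using xy by (metis D_factor mult.left_commute)
    ultimately show ?thesis using coinciding_sums[of x 2 p x' y q y'] by fastforce
  qed
  have intervals: "\<exists>F. card F = 2 ^ (if t \<ge> 0 then nat t else nat (- t - 1))
      \<and> (\<forall>I\<in>F. closed_interval I) \<and> pairwise disjnt F \<and> E x y = \<Union>F"
    if t: "real y = 2 * 4 powi t * real x" for t :: int
  proof (cases "t \<ge> 0")
    case True
    have "real y = real (2 * 4 ^ nat t * x)" using t True by (simp add: power_int_def)
    then have "y = 2 * 4 ^ nat t * x" unfolding of_nat_eq_iff .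
    then have "E x y = E x (2 * 4 ^ nat t * x)" by (rule arg_cong)
    then show ?thesis using E_disjoint_intervals[OF assms(1), of "nat t"] True by simp
  next
    case False
    define k where "k = nat (- t - 1)"
    have "nat (- t) = Suc k" using False by (simp add: k_def)
    then have "(4 :: real) powi t = 1 / 4 ^ Suc k" using False by (simp add: power_int_def inverse_eq_divide power_one_over)
    then have "real x = real (2 * 4 ^ k * y)" using t by (simp add: field_simps)
    then have "x = 2 * 4 ^ k * y" unfolding of_nat_eq_iff .
    then have "E x y = E y (2 * 4 ^ k * y)" by (subst E_commute) (rule arg_cong)
    then show ?thesis using E_disjoint_intervals[OF assms(2), of k] False by (simp add: k_def)
  qed
  have cantorval: "cantorval (E x y)"
    if mixed: "(x \<in> V \<and> y \<in> D) \<or> (x \<in> D \<and> y \<in> V)" and no_double: "\<nexists>t::int. real y = 2 * 4 powi t * real x"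
  proof (rule cantorval_E)
    show "interior (E x y) \<noteq> {}" using mixed interior_E_V_D E_commute by metis
    show "\<exists>z. 0 < z \<and> z < e \<and> z \<notin> E x y" if "0 < e" for e
      using E_holes_at_zero[OF assms no_double that] by blast
  qed
  have finite_union: "\<exists>F. finite F \<and> (\<forall>I\<in>F. closed_interval I) \<and> E x y = \<Union>F"
    if "real y = 2 * 4 powi t * real x" for t :: int
    using intervals[OF that] by (metis card.infinite power_not_zero zero_neq_numeral)
  show ?thesis
  proof (intro conjI impI allI)
    assume "(x \<in> V \<and> y \<in> V) \<or> (x \<in> D \<and> y \<in> D)"
    then obtain n where "n \<ge> 1" "card (sums4 x y n) < 4 ^ n" using few_sums by blast
    from E_cantor_set[OF assms(1) this]
    show "cantor_set (E x y)" "\<exists>d::real. hausdorff_dim (E x y) = ereal d \<and> d \<notin> \<int>" .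
  next
    assume mixed: "(x \<in> V \<and> y \<in> D) \<or> (x \<in> D \<and> y \<in> V)"
    show "(\<exists>F. finite F \<and> (\<forall>I\<in>F. closed_interval I) \<and> E x y = \<Union>F) \<or> cantorval (E x y)"
      using finite_union cantorval[OF mixed] by metis
    show "cantorval (E x y)" if "\<nexists>t::int. real y = 2 * 4 powi t * real x"
      by (rule cantorval[OF mixed that])
  qed (rule intervals)
qed

end
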